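(* For every $n\geq 4$, the star graph $S_n$ is an independent element in the poset $\mathcal{S}_n$.
   Context: All graphs are finite and simple. The star $S_n$ ($n\ge4$) is the graph on vertex set $\{1,\dots,n\}$ whose edges join $n$ to each $j\in\{1,\dots,n-1\}$. The chromatic symmetric function of a graph $G$ with vertices $v_1,\dots,v_n$ is $X_G=\sum_{\kappa}x_{\kappa(v_1)}\cdots x_{\kappa(v_n)}$, summed over all proper colorings $\kappa:V(G)\to\{1,2,3,\dots\}$; it is a homogeneous symmetric function of degree $n$ over $\mathbb{Q}$. Let $s_\lambda$ be the Schur symmetric functions; $[s_\lambda]F$ denotes the coefficient of $s_\lambda$ in $F$ expanded in this basis, and $F$ is Schur-positive if $[s_\lambda]F\ge 0$ for all $\lambda$. For connected graphs $G,H$ on $n$ vertices (for which $[s_{(1^n)}]X_G$ and $[s_{(1^n)}]X_H$ are positive), set $$X_s(G,H)=X_G-\frac{[s_{(1^n)}]X_G}{[s_{(1^n)}]X_H}X_H.$$ $\mathcal{S}_n$ is the poset (not to be confused with the star $S_n$) whose elements are the equivalence classes of connected graphs on $n$ vertices under $G\sim H\iff X_G=X_H$, ordered by $G\geq_s H$ if and only if $X_s(G,H)$ is Schur-positive. An element of a poset is called independent if it is not comparable to any other element of the poset. *)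

theory Defs
  imports
    "HOL-Library.Multiset"
    "HOL-Library.FuncSet"
    "HOL-Library.Function_Algebras"
    "HOL-Algebra.Order"
    "Graph_Theory.Graph_Theory"
begin

text \<open>
  A formal power series over the rationals in the variables \<open>x\<^sub>1, x\<^sub>2, \<dots>\<close> is its coefficient
  function; the monomial \<open>x\<^sub>i\<^sub>1 \<cdots> x\<^sub>i\<^sub>k\<close> is the multiset \<open>{#i\<^sub>1, \<dots>, i\<^sub>k#}\<close>. Indices start at 1, so
  every monomial containing the index 0 has coefficient 0 in the series below. Addition and
  subtraction are the pointwise ones of \<open>Function_Algebras\<close>.
\<close>

type_synonym power_series = "nat multiset \<Rightarrow> rat"

definition scale_series :: "rat \<Rightarrow> power_series \<Rightarrow> power_series" where
  "scale_series c F = (\<lambda>m. c * F m)"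

interpretation series: vector_space scale_series
  by unfold_locales (simp_all add: scale_series_def fun_eq_iff algebra_simps)

text \<open>
  An integer partition is the list of its positive parts in weakly decreasing order. Rows and
  columns of its (English) diagram are numbered from 0, the entries of a tableau from 1.
\<close>

definition partitions :: "nat list set" where
  "partitions = {lam. sorted_wrt (\<ge>) lam \<and> 0 \<notin> set lam}"

definition diagram :: "nat list \<Rightarrow> (nat \<times> nat) set" where
  "diagram lam = (SIGMA i:{..<length lam}. {..<lam ! i})"

definition semistandard_tableaux :: "nat list \<Rightarrow> (nat \<times> nat \<Rightarrow> nat) set" where
  "semistandard_tableaux lam =
     {T \<in> diagram lam \<rightarrow>\<^sub>E {1..}.
        (\<forall>i j j'. (i, j) \<in> diagram lam \<and> (i, j') \<in> diagram lam \<and> j < j' \<longrightarrow> T (i, j) \<le> T (i, j')) \<and>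
        (\<forall>i i' j. (i, j) \<in> diagram lam \<and> (i', j) \<in> diagram lam \<and> i < i' \<longrightarrow> T (i, j) < T (i', j))}"

definition schur :: "nat list \<Rightarrow> power_series" where
  "schur lam = (\<lambda>m. of_nat (card {T \<in> semistandard_tableaux lam.
                                   image_mset T (mset_set (diagram lam)) = m}))"

text \<open>
  The constant \<open>representation\<close> gives the coordinates with respect to a basis, indexed by the basis
  vectors; it is meaningful for series in the span of the Schur functions, that is, for symmetric
  functions.
\<close>

definition schur_coeff :: "nat list \<Rightarrow> power_series \<Rightarrow> rat" where
  "schur_coeff lam F = series.representation (schur ` partitions) F (schur lam)"

definition schur_positive :: "power_series \<Rightarrow> bool" where
  "schur_positive F \<longleftrightarrow> (\<forall>lam \<in> partitions. schur_coeff lam F \<ge> 0)"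

text \<open>
  A finite simple graph is a \<open>pair_graph\<close>: every edge is represented by its two opposite arcs.
  Vertices are natural numbers, so that the graphs on \<open>n\<close> vertices form a set that contains an
  isomorphic copy of each of them.
\<close>

definition connected_graphs :: "nat \<Rightarrow> nat pair_pre_digraph set" where
  "connected_graphs n =
     {G. pair_graph G \<and> Digraph_Component.connected (with_proj G) \<and> card (pverts G) = n}"

definition star_graph :: "nat \<Rightarrow> nat pair_pre_digraph" where
  "star_graph n = \<lparr> pverts = {1..n}, parcs = {n} \<times> {1..n - 1} \<union> {1..n - 1} \<times> {n} \<rparr>"

definition proper_colorings :: "'a pair_pre_digraph \<Rightarrow> ('a \<Rightarrow> nat) set" where
  "proper_colorings G =
     {\<kappa> \<in> pverts G \<rightarrow>\<^sub>E {1..}. \<forall>(u, v) \<in> parcs G. \<kappa> u \<noteq> \<kappa> v}"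

definition chromatic_sym :: "'a pair_pre_digraph \<Rightarrow> power_series" where
  "chromatic_sym G = (\<lambda>m. of_nat (card {\<kappa> \<in> proper_colorings G.
                                          image_mset \<kappa> (mset_set (pverts G)) = m}))"

text \<open>The partition \<open>(1\<^sup>n)\<close> is taken with \<open>n\<close> the number of vertices of the graph.\<close>

definition X_s :: "'a pair_pre_digraph \<Rightarrow> 'a pair_pre_digraph \<Rightarrow> power_series" where
  "X_s G H = chromatic_sym G -
     scale_series
       (schur_coeff (replicate (card (pverts G)) 1) (chromatic_sym G) /
        schur_coeff (replicate (card (pverts H)) 1) (chromatic_sym H))
       (chromatic_sym H)"

definition chromatic_equiv :: "nat \<Rightarrow> nat pair_pre_digraph rel" where
  "chromatic_equiv n =
     {(G, H). G \<in> connected_graphs n \<and> H \<in> connected_graphs n \<and> chromatic_sym G = chromatic_sym H}"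

text \<open>
  \<open>X_s G H\<close> depends only on the classes of \<open>G\<close> and \<open>H\<close>, so any representatives may be used to compare
  classes. Note that \<open>B \<sqsubseteq> A\<close> is \<open>A \<ge>\<^sub>s B\<close>.
\<close>

definition chromatic_poset :: "nat \<Rightarrow> nat pair_pre_digraph set gorder" where
  "chromatic_poset n =
     \<lparr> carrier = connected_graphs n // chromatic_equiv n,
       eq = (=),
       le = (\<lambda>B A. \<exists>G \<in> A. \<exists>H \<in> B. schur_positive (X_s G H)) \<rparr>"

definition independent_element :: "('a, 'b) gorder_scheme \<Rightarrow> 'a \<Rightarrow> bool" where
  "independent_element P a \<longleftrightarrow>
     a \<in> carrier P \<and> (\<forall>b \<in> carrier P. b \<noteq> a \<longrightarrow> \<not> a \<sqsubseteq>\<^bsub>P\<^esub> b \<and> \<not> b \<sqsubseteq>\<^bsub>P\<^esub> a)"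

end

theory Submission
  imports Defs "HOL-Combinatorics.Transposition"
begin

text \<open>
  Let \<open>M\<^sub>\<alpha>\<close> denote the coefficient of the monomial \<open>x\<^sup>\<alpha>\<close>. On symmetric series,
  \<open>[s\<^bsub>(n-1,1)\<^esub>] = M\<^bsub>(n-1,1)\<^esub> - M\<^bsub>(n)\<^esub>\<close> and
  \<open>[s\<^bsub>(n-2,2)\<^esub>] = M\<^bsub>(n-2,2)\<^esub> - M\<^bsub>(n-1,1)\<^esub>\<close>. A connected graph with a stable set of
  \<open>n - 1\<close> vertices is a star, so for every class other than that of the star the first coefficient is
  0 and the second is nonnegative, while for the star the first is positive and the second is negative
  (the centre is always alone in its colour class, so \<open>M\<^bsub>(n-2,2)\<^esub> = 0\<close>).
  Since the coefficients of \<open>s\<^bsub>(1^n)\<^esub>\<close> are positive, \<open>(n-1,1)\<close> refutes one of the two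
  comparisons and \<open>(n-2,2)\<close> the other.

  The coefficient of \<open>s\<^bsub>(1^n)\<^esub>\<close> is the alternating sum of the numbers of proper colourings onto
  \<open>{1..l}\<close>. It satisfies the deletion-contraction recurrence of the number of acyclic orientations
  and is therefore positive.

  That the chromatic symmetric function lies in the span of the Schur functions follows from their
  symmetry and unitriangularity.
\<close>

subsection \<open>Tableaux and contents\<close>

text \<open>\<open>schur_coeff\<close> is a coordinate in a basis, and \<open>representation\<close>
  returns 0 outside the span. No coefficient can therefore be read off before the Schur functions
  are known to be independent and to span the symmetric series in use. After that, a coefficient is
  computed by exhibiting a linear functional with the right values on the Schur functions. The
  functionals come from Jacobi--Trudi: pairing with h_\<alpha> extracts M_\<alpha>, which gives two
  terms for a two-row shape and one term per composition of n for the column. On a family of maps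
  the column functional is a signed count of the members whose values are exactly {1..l}. One
  involution, which takes a point out of its class or puts it back, evaluates this count both for
  Schur functions and for the edgeless graph.\<close>

definition content :: "('a \<Rightarrow> nat) \<Rightarrow> 'a set \<Rightarrow> nat multiset" where
  "content \<kappa> A = image_mset \<kappa> (mset_set A)"

text \<open>Tableaux and colourings are both maps on a finite set counted by content; this common
  form allows the signed count to be set up once for both.\<close>

definition enumerator :: "'a set \<Rightarrow> ('a \<Rightarrow> nat) set \<Rightarrow> power_series" where
  "enumerator A K = (\<lambda>m. of_nat (card {\<kappa> \<in> K. content \<kappa> A = m}))"

lemma schur_eq_enumerator: "schur lam = enumerator (diagram lam) (semistandard_tableaux lam)"
  by (simp add: schur_def enumerator_def content_def)

lemma chromatic_sym_eq_enumerator: "chromatic_sym G = enumerator (pverts G) (proper_colorings G)"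
  by (simp add: chromatic_sym_def enumerator_def content_def)

lemma count_content: "finite A \<Longrightarrow> count (content \<kappa> A) x = card {a \<in> A. \<kappa> a = x}"
  unfolding content_def
  by (subst count_image_mset') (simp add: eq_commute[of x])

lemma set_mset_content [simp]: "finite A \<Longrightarrow> set_mset (content \<kappa> A) = \<kappa> ` A"
  by (simp add: content_def)

lemma size_content [simp]: "size (content \<kappa> A) = card A"
  by (simp add: content_def)

text \<open>A map in the fibre has its values in the finite support of \<open>m\<close> and is
  \<open>undefined\<close> off \<open>A\<close>. Finiteness matters because \<open>card\<close> of
  an infinite set is 0, which would spoil comparisons by injections.\<close>

lemma finite_content_fibre:
  assumes "finite A" "K \<subseteq> A \<rightarrow>\<^sub>E UNIV"
  shows "finite {\<kappa> \<in> K. content \<kappa> A = m}"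
proof (rule finite_subset)
  show "{\<kappa> \<in> K. content \<kappa> A = m} \<subseteq> A \<rightarrow>\<^sub>E set_mset m"
    using assms by (auto simp: PiE_iff)
  show "finite (A \<rightarrow>\<^sub>E set_mset m)"
    using assms by (intro finite_PiE) auto
qed

lemma finite_diagram [simp]: "finite (diagram lam)"
  by (simp add: diagram_def)

lemma card_diagram: "card (diagram lam) = sum_list lam"
  by (simp add: diagram_def sum_list_sum_nth atLeast0LessThan)

lemma mem_diagram [simp]: "(i, j) \<in> diagram lam \<longleftrightarrow> i < length lam \<and> j < lam ! i"
  by (simp add: diagram_def)

lemma partitions_antimono:
  "lam \<in> partitions \<Longrightarrow> i \<le> i' \<Longrightarrow> i' < length lam \<Longrightarrow> lam ! i' \<le> lam ! i"
  by (cases "i = i'") (auto simp: partitions_def sorted_wrt_iff_nth_less)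

lemma partitions_pos: "lam \<in> partitions \<Longrightarrow> i < length lam \<Longrightarrow> 0 < lam ! i"
  by (metis (no_types, lifting) CollectD bot_nat_0.not_eq_extremum nth_mem partitions_def)

lemma mem_diagram_mono:
  assumes "lam \<in> partitions" "(i, j) \<in> diagram lam" "i' \<le> i" "j' \<le> j"
  shows "(i', j') \<in> diagram lam"
proof -
  have "lam ! i \<le> lam ! i'" using partitions_antimono[OF assms(1), of i' i] assms by simp
  then show ?thesis using assms by simp
qed

lemma finite_partitions_of: "finite {lam \<in> partitions. sum_list lam = n}"
proof (rule finite_subset)
  show "{lam \<in> partitions. sum_list lam = n} \<subseteq> {xs. set xs \<subseteq> {..n} \<and> length xs \<le> n}"
  proof clarify
    fix lam assume lam: "lam \<in> partitions" and n: "n = sum_list lam"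
    have "length lam = (\<Sum>x\<leftarrow>lam. 1)" by (induction lam) auto
    also have "\<dots> \<le> sum_list (map id lam)"
      using lam by (intro sum_list_mono) (auto simp: partitions_def Suc_le_eq intro: gr0I)
    finally show "set lam \<subseteq> {..sum_list lam} \<and> length lam \<le> sum_list lam"
      using member_le_sum_list by auto
  qed
qed (rule finite_lists_length_le, simp)

subsection \<open>Unitriangularity of the Schur functions\<close>

text \<open>The monomial x^\<lambda>, as the content of the tableau whose row \<open>i\<close> is
  filled with \<open>Suc i\<close>: rows start at 0, entries at 1.\<close>

definition row_content :: "nat list \<Rightarrow> nat multiset" where
  "row_content lam = content (\<lambda>c. Suc (fst c)) (diagram lam)"

text \<open>The weight \<open>\<Sum> i \<lambda>\<^sub>i\<close> replaces the dominance order in the triangularity argument.\<close>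

definition row_weight :: "nat list \<Rightarrow> nat" where
  "row_weight lam = (\<Sum>c \<in> diagram lam. fst c)"

lemma semistandardD:
  assumes "T \<in> semistandard_tableaux lam"
  shows "T \<in> extensional (diagram lam)"
    and "(i, j) \<in> diagram lam \<Longrightarrow> 1 \<le> T (i, j)"
    and "(i, j) \<in> diagram lam \<Longrightarrow> (i, j') \<in> diagram lam \<Longrightarrow> j \<le> j' \<Longrightarrow> T (i, j) \<le> T (i, j')"
    and "(i, j) \<in> diagram lam \<Longrightarrow> (i', j) \<in> diagram lam \<Longrightarrow> i < i' \<Longrightarrow> T (i, j) < T (i', j)"
  using assms unfolding semistandard_tableaux_def
  by (auto simp: PiE_iff simp del: mem_diagram) (metis le_eq_less_or_eq order_refl)

lemma semistandardI:
  assumes "T \<in> extensional (diagram lam)"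
    and "\<And>i j. (i, j) \<in> diagram lam \<Longrightarrow> 1 \<le> T (i, j)"
    and "\<And>i j j'. (i, j) \<in> diagram lam \<Longrightarrow> (i, j') \<in> diagram lam \<Longrightarrow> j < j' \<Longrightarrow> T (i, j) \<le> T (i, j')"
    and "\<And>i i' j. (i, j) \<in> diagram lam \<Longrightarrow> (i', j) \<in> diagram lam \<Longrightarrow> i < i' \<Longrightarrow> T (i, j) < T (i', j)"
  shows "T \<in> semistandard_tableaux lam"
  using assms unfolding semistandard_tableaux_def by (auto simp: PiE_iff simp del: mem_diagram)

lemma semistandard_subset: "semistandard_tableaux lam \<subseteq> diagram lam \<rightarrow>\<^sub>E UNIV"
  by (auto simp: semistandard_tableaux_def PiE_iff extensional_def simp del: mem_diagram)

text \<open>A column starts with an entry at least 1 and grows by at least 1 per row; the cells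
  above are present because the shape is a partition.\<close>

lemma semistandard_row_less:
  assumes "lam \<in> partitions" "T \<in> semistandard_tableaux lam" "(i, j) \<in> diagram lam"
  shows "i < T (i, j)"
  using assms(3)
proof (induction i)
  case 0
  then show ?case using semistandardD(2)[OF assms(2)] by fastforce
next
  case (Suc i)
  then have "(i, j) \<in> diagram lam"
    using mem_diagram_mono[OF assms(1)] by (meson le_refl le_SucI)
  then show ?case
    using Suc semistandardD(4)[OF assms(2), of i j "Suc i"] by fastforce
qed

lemma sum_mset_content: "(\<Sum>x\<in>#content \<kappa> A. f x) = (\<Sum>a\<in>A. f (\<kappa> a))"
  by (simp add: content_def sum_unfold_sum_mset multiset.map_comp comp_def)

lemma row_weight_eq: "row_weight lam = (\<Sum>x\<in>#row_content lam. x - 1)"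
  by (simp add: row_weight_def row_content_def sum_mset_content)

lemma count_row_content:
  "count (row_content lam) x = (if 1 \<le> x \<and> x \<le> length lam then lam ! (x - 1) else 0)"
proof -
  have "{c \<in> diagram lam. Suc (fst c) = x} =
      (if 1 \<le> x \<and> x \<le> length lam then {x - 1} \<times> {..<lam ! (x - 1)} else {})"
    by (auto simp: diagram_def)
  then show ?thesis by (simp add: row_content_def count_content)
qed

lemma size_row_content [simp]: "size (row_content lam) = sum_list lam"
  by (simp add: row_content_def card_diagram)

lemma row_content_inj:
  assumes "lam \<in> partitions" "mu \<in> partitions" "row_content lam = row_content mu"
  shows "lam = mu"
proof -
  have *: "(if i < length lam then lam ! i else 0) = (if i < length mu then mu ! i else 0)" for i
    using arg_cong[OF assms(3), of "\<lambda>m. count m (Suc i)"] by (auto simp: count_row_content Suc_le_eq split: if_splits)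
  have "length lam = length mu"
    using *[of "length lam"] *[of "length mu"] partitions_pos[OF assms(1), of "length mu"]
      partitions_pos[OF assms(2), of "length lam"]
    by (metis gr_implies_not0 linorder_neqE_nat order.asym)
  then show ?thesis using * by (intro nth_equalityI) (auto split: if_splits, metis)
qed

lemma schur_row_content_self:
  assumes "lam \<in> partitions"
  shows "schur lam (row_content lam) = 1"
proof -
  define T0 where "T0 = restrict (\<lambda>c. Suc (fst c)) (diagram lam)"
  have "{T \<in> semistandard_tableaux lam. content T (diagram lam) = row_content lam} = {T0}"
  proof (intro equalityI subsetI)
    fix T assume "T \<in> {T \<in> semistandard_tableaux lam. content T (diagram lam) = row_content lam}"
    then have T: "T \<in> semistandard_tableaux lam" and c: "content T (diagram lam) = row_content lam"
      by auto
    have ge: "fst x < T x" if "x \<in> diagram lam" for x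
      using semistandard_row_less[OF assms T, of "fst x" "snd x"] that by simp
    have "(\<Sum>x\<in>diagram lam. T x) = (\<Sum>x\<in>diagram lam. Suc (fst x))"
      using arg_cong[OF c, of sum_mset] by (simp add: row_content_def sum_unfold_sum_mset content_def)
    \<comment> \<open>Every entry is at least its row number plus one, and the totals agree, so no
      entry can exceed this minimum.\<close>
    then have "\<forall>x\<in>diagram lam. Suc (fst x) = T x"
      using sum_mono_inv[of "\<lambda>x. Suc (fst x)" "diagram lam" T] ge by (simp add: Suc_le_eq)
    then have "T = T0"
      using semistandardD(1)[OF T] unfolding T0_def
      by (intro extensionalityI[of _ "diagram lam"]) auto
    then show "T \<in> {T0}" by simp
  next
    fix T assume "T \<in> {T0}"
    then have T: "T = T0" by simp
    have "T0 \<in> semistandard_tableaux lam"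
      unfolding T0_def by (rule semistandardI) (auto simp del: mem_diagram)
    moreover have "content T0 (diagram lam) = row_content lam"
      unfolding content_def row_content_def T0_def by (intro image_mset_cong) auto
    ultimately show "T \<in> {T \<in> semistandard_tableaux lam. content T (diagram lam) = row_content lam}"
      using T by simp
  qed
  then show ?thesis by (simp add: schur_eq_enumerator enumerator_def)
qed

lemma schur_nonzeroD:
  assumes "schur lam m \<noteq> 0"
  obtains T where "T \<in> semistandard_tableaux lam" "content T (diagram lam) = m"
proof -
  have "{T \<in> semistandard_tableaux lam. content T (diagram lam) = m} \<noteq> {}"
  proof
    assume e: "{T \<in> semistandard_tableaux lam. content T (diagram lam) = m} = {}"
    show False using assms unfolding schur_eq_enumerator enumerator_def e by simp
  qed
  then show ?thesis using that by blast
qed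

lemma row_weight_le:
  assumes "lam \<in> partitions" "schur lam m \<noteq> 0"
  shows "row_weight lam \<le> (\<Sum>x\<in>#m. x - 1)"
proof -
  obtain T where T: "T \<in> semistandard_tableaux lam" "content T (diagram lam) = m"
    using schur_nonzeroD[OF assms(2)] .
  have "fst x \<le> T x - 1" if "x \<in> diagram lam" for x
    using semistandard_row_less[OF assms(1) T(1), of "fst x" "snd x"] that by simp
  then show ?thesis
    unfolding T(2)[symmetric] sum_mset_content row_weight_def by (rule sum_mono)
qed

text \<open>If the weights were equal, every entry would be the least allowed in its row, so the
  content would be \<open>row_content lam\<close>, which recovers \<open>lam\<close>.\<close>

lemma schur_row_content_less:
  assumes "lam \<in> partitions" "mu \<in> partitions" "schur lam (row_content mu) \<noteq> 0" "lam \<noteq> mu"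
  shows "row_weight lam < row_weight mu"
proof (rule ccontr)
  assume "\<not> ?thesis"
  then have eq: "row_weight lam = row_weight mu"
    using row_weight_le[OF assms(1,3)] using row_weight_eq[of mu] by linarith
  obtain T where T: "T \<in> semistandard_tableaux lam" "content T (diagram lam) = row_content mu"
    using schur_nonzeroD[OF assms(3)] .
  have ge: "fst x < T x" if "x \<in> diagram lam" for x
    using semistandard_row_less[OF assms(1) T(1), of "fst x" "snd x"] that by simp
  have "(\<Sum>x\<in>diagram lam. T x - 1) = (\<Sum>x\<in>diagram lam. fst x)"
    using eq row_weight_eq[of mu] by (simp add: T(2)[symmetric] sum_mset_content row_weight_def)
  then have "\<forall>x\<in>diagram lam. fst x = T x - 1"
    using sum_mono_inv[of fst "diagram lam" "\<lambda>x. T x - 1"] ge by fastforce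
  then have "T x = Suc (fst x)" if "x \<in> diagram lam" for x
    using ge[OF that] that by force
  then have "content T (diagram lam) = row_content lam"
    unfolding content_def row_content_def by (intro image_mset_cong) auto
  then show False using row_content_inj assms T(2) by metis
qed

section \<open>Linear independence, and coordinates as functionals\<close>

lemma inj_on_schur: "inj_on schur partitions"
proof (rule inj_onI, rule ccontr)
  \<comment> \<open>Each of the two has coefficient 1 at the leading monomial of the other, which
    yields two contradictory strict inequalities.\<close>
  fix lam mu assume *: "lam \<in> partitions" "mu \<in> partitions" "schur lam = schur mu" "lam \<noteq> mu"
  then have "row_weight lam < row_weight mu"
    by (intro schur_row_content_less) (auto simp: schur_row_content_self)
  moreover have "row_weight mu < row_weight lam"
    using * by (intro schur_row_content_less) (auto simp: schur_row_content_self dest: sym)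
  ultimately show False by simp
qed

lemma sum_fun_apply: "(\<Sum>i\<in>I. f i) x = (\<Sum>i\<in>I. f i (x :: 'a) :: rat)"
  by (induction I rule: infinite_finite_induct) auto

lemma scale_series_apply: "scale_series c F m = c * F m"
  by (simp add: scale_series_def)

lemma independent_schur: "series.independent (schur ` partitions)"
proof
  assume "series.dependent (schur ` partitions)"
  then obtain S u v where S: "finite S" "S \<subseteq> schur ` partitions"
    and sum: "(\<Sum>v\<in>S. scale_series (u v) v) = 0" and v: "v \<in> S" "u v \<noteq> 0"
    unfolding series.dependent_explicit by blast
  obtain P where P: "P \<subseteq> partitions" "S = schur ` P"
    using S(2) by (meson subset_imageE)
  have inj: "inj_on schur P" using inj_on_schur P(1) by (rule inj_on_subset)
  have finP: "finite P" using S(1) P(2) inj by (simp add: finite_image_iff)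
  define Q where "Q = {lam \<in> P. u (schur lam) \<noteq> 0}"
  have "finite Q" "Q \<noteq> {}" using finP v P by (auto simp: Q_def)
  \<comment> \<open>Least weight among the nonzero coefficients: any other Schur function containing
    the monomial of \<open>mu\<close> would weigh strictly less.\<close>
  then obtain mu where mu: "mu \<in> Q" "\<And>lam. lam \<in> Q \<Longrightarrow> row_weight mu \<le> row_weight lam"
    using ex_min_if_finite[of "row_weight ` Q"] by (metis (mono_tags, lifting) arg_min_if_finite(1) arg_min_least)
  have "0 = (\<Sum>lam\<in>P. u (schur lam) * schur lam (row_content mu))"
    using arg_cong[OF sum, of "\<lambda>F. F (row_content mu)"] unfolding P(2)
    by (simp add: sum.reindex[OF inj] sum_fun_apply scale_series_apply)
  also have "\<dots> = (\<Sum>lam\<in>{mu}. u (schur lam) * schur lam (row_content mu))"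
  proof (rule sum.mono_neutral_right[OF finP])
    show "{mu} \<subseteq> P" using mu by (auto simp: Q_def)
    show "\<forall>lam\<in>P - {mu}. u (schur lam) * schur lam (row_content mu) = 0"
    proof (intro ballI, rule ccontr)
      fix lam assume lam: "lam \<in> P - {mu}" and nz: "u (schur lam) * schur lam (row_content mu) \<noteq> 0"
      then have "row_weight lam < row_weight mu"
        using mu(1) P(1) by (intro schur_row_content_less) (auto simp: Q_def)
      moreover have "lam \<in> Q" using lam nz by (simp add: Q_def)
      ultimately show False using mu(2) by fastforce
    qed
  qed
  also have "\<dots> = u (schur mu)"
    using mu(1) P(1) by (auto simp: Q_def schur_row_content_self)
  finally show False using mu(1) by (simp add: Q_def)
qed

text \<open>Coordinates in a basis are unique, so a linear functional with these values on the basis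
  computes them. The column and two-row coefficients below are evaluated in this way.\<close>

lemma schur_coeff_eqI:
  assumes F: "F \<in> series.span (schur ` partitions)" and lam: "lam \<in> partitions"
    and add: "\<And>F G. \<phi> (F + G) = \<phi> F + \<phi> G"
    and scale: "\<And>c F. \<phi> (scale_series c F) = c * \<phi> F"
    and schur: "\<And>mu. mu \<in> partitions \<Longrightarrow> \<phi> (schur mu) = (if mu = lam then 1 else 0)"
  shows "schur_coeff lam F = \<phi> F"
proof -
  \<comment> \<open>Membership is carried through the induction because
    \<open>representation\<close> is additive only on the span.\<close>
  have "F \<in> series.span (schur ` partitions) \<and> schur_coeff lam F = \<phi> F"
    using F
  proof (induction rule: series.span_induct_alt)
    case base
    have "\<phi> 0 = 0" using scale[of 0 0] by simp
    then have "schur_coeff lam 0 = \<phi> 0"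
      by (simp add: schur_coeff_def series.representation_zero)
    then show ?case by (blast intro: series.span_zero)
  next
    case (step c b F)
    then obtain mu where mu: "mu \<in> partitions" "b = schur mu" by auto
    have b: "b \<in> series.span (schur ` partitions)" using step by (simp add: series.span_base)
    have "schur_coeff lam (scale_series c b + F) = c * schur_coeff lam b + schur_coeff lam F"
      unfolding schur_coeff_def
      using independent_schur b step.IH
      by (simp add: series.representation_add series.representation_scale series.span_scale)
    moreover have "schur_coeff lam b = (if mu = lam then 1 else 0)"
      unfolding schur_coeff_def mu(2)
      using inj_on_eq_iff[OF inj_on_schur lam mu(1)] mu(1)
      by (auto simp: series.representation_basis[OF independent_schur])
    ultimately have "schur_coeff lam (scale_series c b + F) = \<phi> (scale_series c b + F)"
      using step.IH unfolding add scale mu(2) schur[OF mu(1)] by simp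
    then show ?case
      using step.IH b by (blast intro: series.span_add series.span_scale)
  qed
  then show ?thesis by simp
qed

subsection \<open>Symmetric series\<close>

text \<open>Only adjacent swaps are asked for: they are what the Bender--Knuth map supplies, and
  they suffice to sort the exponents of a monomial. The bound on \<open>a\<close> leaves the index 0
  fixed.\<close>

definition symmetric_series :: "nat \<Rightarrow> power_series set" where
  "symmetric_series n =
     {F. (\<forall>m. F m \<noteq> 0 \<longrightarrow> 0 \<notin># m \<and> size m = n) \<and>
         (\<forall>m. \<forall>a\<ge>1. F (image_mset (transpose a (Suc a)) m) = F m)}"

lemma subspace_symmetric_series: "series.subspace (symmetric_series n)"
  unfolding series.subspace_def
proof (intro conjI ballI allI)
  show "0 \<in> symmetric_series n" by (simp add: symmetric_series_def)
  fix F assume F: "F \<in> symmetric_series n"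
  show "scale_series c F \<in> symmetric_series n" for c
    using F by (simp add: symmetric_series_def scale_series_apply)
  fix G assume G: "G \<in> symmetric_series n"
  have "0 \<notin># m \<and> size m = n" if "(F + G) m \<noteq> 0" for m
  proof (cases "F m = 0")
    case True
    then have "G m \<noteq> 0" using that by simp
    then show ?thesis using G by (simp add: symmetric_series_def)
  next
    case False
    then show ?thesis using F by (simp add: symmetric_series_def)
  qed
  moreover have "(F + G) (image_mset (transpose a (Suc a)) m) = (F + G) m" if "a \<ge> 1" for a m
    using F G that by (simp add: symmetric_series_def)
  ultimately show "F + G \<in> symmetric_series n"
    unfolding symmetric_series_def by blast
qed

text \<open>The additive form avoids truncated subtraction. It shows that a swap lowers the sum of
  the indices exactly when \<open>Suc a\<close> occurs more often than \<open>a\<close>.\<close>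

lemma sum_mset_transpose:
  "(\<Sum>x\<in>#image_mset (transpose a (Suc a)) m. x) + count m (Suc a) = (\<Sum>x\<in>#m. x) + count m a"
  by (induction m) (auto simp: transpose_def)

lemma row_content_exists:
  assumes "0 \<notin># m" and anti: "\<And>a. 1 \<le> a \<Longrightarrow> count m (Suc a) \<le> count m a"
  obtains lam where "lam \<in> partitions" "row_content lam = m"
proof -
  \<comment> \<open>The 0 covers the empty multiset, whose partition is the empty list.\<close>
  define L where "L = Max (insert 0 (set_mset m))"
  define lam where "lam = map (\<lambda>i. count m (Suc i)) [0..<L]"
  have anti': "count m y \<le> count m x" if "1 \<le> x" "x \<le> y" for x y
    using that(2,1)
  proof (induction y rule: dec_induct)
    case (step y)
    then show ?case using anti[of y] by linarith
  qed simp
  have pos: "0 < count m x" if "1 \<le> x" "x \<le> L" for x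
  proof -
    have "L \<in> insert 0 (set_mset m)" unfolding L_def by (rule Max_in) auto
    then have "0 < count m L" using that by auto
    then show ?thesis using anti'[OF that] by linarith
  qed
  have zero: "count m x = 0" if "L < x" for x
  proof (rule ccontr)
    assume "count m x \<noteq> 0"
    then have "x \<in> insert 0 (set_mset m)" by (simp add: count_inI)
    then have "x \<le> L" unfolding L_def by (intro Max_ge) auto
    then show False using that by simp
  qed
  have "lam \<in> partitions"
  proof -
    have "sorted_wrt (\<ge>) lam"
      using anti' by (simp add: lam_def sorted_wrt_iff_nth_less)
    moreover have "lam ! i \<noteq> 0" if "i < length lam" for i
      using pos[of "Suc i"] that by (simp add: lam_def)
    then have "0 \<notin> set lam" by (metis in_set_conv_nth)
    ultimately show ?thesis by (simp add: partitions_def)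
  qed
  moreover have "row_content lam = m"
  proof (rule multiset_eqI)
    fix x
    have "count m 0 = 0" using assms(1) by (simp add: not_in_iff)
    then show "count (row_content lam) x = count m x"
      using zero[of x] by (cases x) (auto simp: count_row_content lam_def)
  qed
  ultimately show ?thesis by (rule that)
qed

text \<open>Exponents are sorted by adjacent swaps: as long as one is followed by a larger one,
  exchanging them lowers the sum of the indices and keeps the coefficient. The process ends at the
  monomial of a partition.\<close>

lemma symmetric_series_eq_0:
  assumes F: "F \<in> symmetric_series n" and vanish: "\<And>lam. lam \<in> partitions \<Longrightarrow> F (row_content lam) = 0"
  shows "F m = 0"
proof (induction "\<Sum>x\<in>#m. x" arbitrary: m rule: less_induct)
  case less
  show ?case
  proof (cases "0 \<in># m")
    case True
    then show ?thesis using F by (auto simp: symmetric_series_def)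
  next
    case False
    show ?thesis
    proof (cases "\<forall>a\<ge>1. count m (Suc a) \<le> count m a")
      case True
      then show ?thesis using row_content_exists[OF False] vanish by metis
    next
      case False
      then obtain a where a: "1 \<le> a" "count m a < count m (Suc a)" by (auto simp: not_le)
      have "F (image_mset (transpose a (Suc a)) m) = 0"
        using sum_mset_transpose[of a m] a by (intro less) simp
      then show ?thesis using F a by (auto simp: symmetric_series_def)
    qed
  qed
qed

lemma row_weight_bound:
  assumes "lam \<in> partitions"
  shows "row_weight lam \<le> sum_list lam * sum_list lam"
proof -
  have "fst c \<le> sum_list lam" if "c \<in> diagram lam" for c
  proof -
    have "(\<lambda>i. (i, 0)) ` {..<length lam} \<subseteq> diagram lam"
      using partitions_pos[OF assms] by auto
    then have "card ((\<lambda>i. (i, 0 :: nat)) ` {..<length lam}) \<le> sum_list lam"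
      using card_mono[OF finite_diagram] by (metis card_diagram)
    then have "length lam \<le> sum_list lam" by (simp add: card_image inj_on_def)
    then show ?thesis using that by (auto simp: diagram_def)
  qed
  then show ?thesis
    using sum_bounded_above[of "diagram lam" fst "sum_list lam"]
    by (simp add: row_weight_def card_diagram)
qed

subsection \<open>Symmetry of the Schur functions\<close>

text \<open>Row lengths of the subshape of the entries at most \<open>k\<close>; over all
  \<open>k\<close> they form the Gelfand--Tsetlin pattern of the tableau.\<close>

definition row_count :: "nat list \<Rightarrow> (nat \<times> nat \<Rightarrow> nat) \<Rightarrow> nat \<Rightarrow> nat \<Rightarrow> nat" where
  "row_count lam T k r = card {j. (r, j) \<in> diagram lam \<and> T (r, j) \<le> k}"

lemma finite_row: "finite {j. (r, j) \<in> diagram lam \<and> P j}"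
  by (rule finite_subset[of _ "{..<lam ! r}"]) auto

text \<open>Rows increase weakly, so the entries at most \<open>k\<close> occupy an initial segment
  of their row.\<close>

lemma row_count_le_iff:
  assumes T: "T \<in> semistandard_tableaux lam" and rj: "(r, j) \<in> diagram lam"
  shows "T (r, j) \<le> k \<longleftrightarrow> j < row_count lam T k r"
proof -
  let ?S = "{j. (r, j) \<in> diagram lam \<and> T (r, j) \<le> k}"
  have down: "j' \<in> ?S" if "j \<in> ?S" "j' \<le> j" for j j'
    using that semistandardD(3)[OF T, of r j' j] by auto
  show ?thesis
  proof
    assume "T (r, j) \<le> k"
    then have "{..j} \<subseteq> ?S" using down rj by auto
    then show "j < row_count lam T k r"
      using card_mono[OF finite_row, of "{..j}" r lam "\<lambda>j. T (r, j) \<le> k"]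
      unfolding row_count_def by (simp del: mem_diagram)
  next
    assume *: "j < row_count lam T k r"
    show "T (r, j) \<le> k"
    proof (rule ccontr)
      assume "\<not> T (r, j) \<le> k"
      then have "x < j" if "x \<in> ?S" for x
        using down[OF that, of j] by (cases "x < j") auto
      then have "?S \<subseteq> {..<j}" by blast
      then have "row_count lam T k r \<le> j"
        unfolding row_count_def using card_mono[of "{..<j}" ?S] by simp
      then show False using * by simp
    qed
  qed
qed

lemma row_count_le: "row_count lam T k r \<le> (if r < length lam then lam ! r else 0)"
proof -
  have "{j. (r, j) \<in> diagram lam \<and> T (r, j) \<le> k} \<subseteq> {..<if r < length lam then lam ! r else 0}"
    by auto
  then have "row_count lam T k r \<le> card {..<if r < length lam then lam ! r else 0}"
    unfolding row_count_def by (rule card_mono[rotated]) simp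
  then show ?thesis by simp
qed

lemma row_count_mem_diagram: "j < row_count lam T k r \<Longrightarrow> (r, j) \<in> diagram lam"
  using row_count_le[of lam T k r] by (auto split: if_splits)

lemma row_count_eqI:
  assumes "\<And>j. (r, j) \<in> diagram lam \<Longrightarrow> T (r, j) \<le> k \<longleftrightarrow> j < b" "\<And>j. j < b \<Longrightarrow> (r, j) \<in> diagram lam"
  shows "row_count lam T k r = b"
proof -
  have "{j. (r, j) \<in> diagram lam \<and> T (r, j) \<le> k} = {..<b}" using assms by blast
  then show ?thesis by (simp add: row_count_def)
qed

lemma row_count_mono: "k \<le> k' \<Longrightarrow> row_count lam T k r \<le> row_count lam T k' r"
  unfolding row_count_def by (rule card_mono[OF finite_row]) auto

text \<open>Columns are strict, so the cell above an entry at most \<open>Suc k\<close> holds an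
  entry at most \<open>k\<close>. This is the interlacing condition of the pattern.\<close>

lemma row_count_interlace:
  assumes lam: "lam \<in> partitions" and T: "T \<in> semistandard_tableaux lam"
  shows "row_count lam T (Suc k) (Suc r) \<le> row_count lam T k r"
  unfolding row_count_def
proof (rule card_mono[OF finite_row], clarify)
  fix j assume j: "(Suc r, j) \<in> diagram lam" "T (Suc r, j) \<le> Suc k"
  then have "(r, j) \<in> diagram lam"
    using mem_diagram_mono[OF lam, of "Suc r" j r j] by simp
  then show "(r, j) \<in> diagram lam \<and> T (r, j) \<le> k"
    using semistandardD(4)[OF T, of r j "Suc r"] j by simp
qed

lemma count_content_row_count:
  "count (content T (diagram lam)) (Suc k) + (\<Sum>r<length lam. row_count lam T k r) =
     (\<Sum>r<length lam. row_count lam T (Suc k) r)"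
proof -
  have *: "(\<Sum>r<length lam. row_count lam T k r) = card {c \<in> diagram lam. T c \<le> k}" for k
  proof -
    have "{c \<in> diagram lam. T c \<le> k} = (SIGMA r:{..<length lam}. {j. (r, j) \<in> diagram lam \<and> T (r, j) \<le> k})"
      by auto
    then show ?thesis using finite_row by (simp add: row_count_def card_SigmaI del: mem_diagram)
  qed
  have "{c \<in> diagram lam. T c \<le> Suc k} = {c \<in> diagram lam. T c = Suc k} \<union> {c \<in> diagram lam. T c \<le> k}"
    by auto
  then show ?thesis
    unfolding * count_content[OF finite_diagram] by (simp add: card_Un_disjoint disjoint_iff)
qed

text \<open>
  The Bender--Knuth involution, read off Gelfand--Tsetlin patterns: with the shapes of the entries
  \<open>< a\<close> and \<open>\<le> a + 1\<close> fixed, the row lengths \<open>\<rho>\<close> of the shape of the entries \<open>\<le> a\<close> range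
  independently over intervals \<open>[lo, hi]\<close>, and reflecting each of them exchanges the
  multiplicities of \<open>a\<close> and \<open>a + 1\<close>.
\<close>

definition bk_lo :: "nat list \<Rightarrow> nat \<Rightarrow> (nat \<times> nat \<Rightarrow> nat) \<Rightarrow> nat \<Rightarrow> nat" where
  "bk_lo lam a T r = max (row_count lam T (a - 1) r) (row_count lam T (Suc a) (Suc r))"

text \<open>The top row has no row above it, hence no upper constraint from the shape of the entries
  below \<open>a\<close>.\<close>

definition bk_hi :: "nat list \<Rightarrow> nat \<Rightarrow> (nat \<times> nat \<Rightarrow> nat) \<Rightarrow> nat \<Rightarrow> nat" where
  "bk_hi lam a T r = (case r of 0 \<Rightarrow> row_count lam T (Suc a) 0
     | Suc q \<Rightarrow> min (row_count lam T (Suc a) (Suc q)) (row_count lam T (a - 1) q))"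

text \<open>Reflection of the row count in its interval; by \<open>bk_bounds\<close> the truncated
  subtraction is exact.\<close>

definition bk_row :: "nat list \<Rightarrow> nat \<Rightarrow> (nat \<times> nat \<Rightarrow> nat) \<Rightarrow> nat \<Rightarrow> nat" where
  "bk_row lam a T r = bk_lo lam a T r + bk_hi lam a T r - row_count lam T a r"

definition bender_knuth :: "nat list \<Rightarrow> nat \<Rightarrow> (nat \<times> nat \<Rightarrow> nat) \<Rightarrow> nat \<times> nat \<Rightarrow> nat" where
  "bender_knuth lam a T = (\<lambda>c \<in> diagram lam.
     if T c = a \<or> T c = Suc a then (if snd c < bk_row lam a T (fst c) then a else Suc a) else T c)"

context
  fixes lam :: "nat list" and a :: nat and T :: "nat \<times> nat \<Rightarrow> nat"
  assumes lam: "lam \<in> partitions" and a: "1 \<le> a" and T: "T \<in> semistandard_tableaux lam"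
begin

lemma bk_bounds:
  "bk_lo lam a T r \<le> row_count lam T a r" "row_count lam T a r \<le> bk_hi lam a T r"
proof -
  show "bk_lo lam a T r \<le> row_count lam T a r"
    using row_count_interlace[OF lam T, of a r] row_count_mono[of "a - 1" a lam T r]
    by (simp add: bk_lo_def)
  show "row_count lam T a r \<le> bk_hi lam a T r"
    using row_count_interlace[OF lam T, of "a - 1" "r - 1"] row_count_mono[of a "Suc a" lam T r] a
    by (auto simp: bk_hi_def split: nat.split)
qed

lemma bk_row_bounds:
  "bk_lo lam a T r \<le> bk_row lam a T r" "bk_row lam a T r \<le> bk_hi lam a T r"
  using bk_bounds[of r] by (auto simp: bk_row_def)

lemma bk_row_between:
  "row_count lam T (a - 1) r \<le> bk_row lam a T r" "bk_row lam a T r \<le> row_count lam T (Suc a) r"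
  using bk_row_bounds[of r] by (auto simp: bk_lo_def bk_hi_def split: nat.splits)

lemma bender_knuth_semistandard: "bender_knuth lam a T \<in> semistandard_tableaux lam"
proof (rule semistandardI)
  show "bender_knuth lam a T \<in> extensional (diagram lam)"
    by (simp add: bender_knuth_def)
  show "1 \<le> bender_knuth lam a T (i, j)" if "(i, j) \<in> diagram lam" for i j
    using semistandardD(2)[OF T that] that a by (auto simp: bender_knuth_def)
  show "bender_knuth lam a T (i, j) \<le> bender_knuth lam a T (i, j')"
    if *: "(i, j) \<in> diagram lam" "(i, j') \<in> diagram lam" "j < j'" for i j j'
    using semistandardD(3)[OF T *(1,2)] * by (auto simp: bender_knuth_def)
  show "bender_knuth lam a T (i, j) < bender_knuth lam a T (i', j)"
    if ij: "(i, j) \<in> diagram lam" and i'j: "(i', j) \<in> diagram lam" and less: "i < i'" for i i' j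
  proof -
    have lt: "T (i, j) < T (i', j)" using semistandardD(4)[OF T ij i'j less] .
    \<comment> \<open>Only a vertical pair \<open>a\<close> over \<open>Suc a\<close> is in danger.
      The upper cell lies to the left of \<open>bk_lo\<close> of its row and the lower one not to
      the left of \<open>bk_hi\<close> of its row, so the new boundaries leave both entries
      alone.\<close>
    have "bender_knuth lam a T (i, j) = a \<and> bender_knuth lam a T (i', j) = Suc a"
      if eq: "T (i, j) = a" "T (i', j) = Suc a"
    proof -
      have i': "i' = Suc i"
      proof (rule ccontr)
        assume "i' \<noteq> Suc i"
        then have "Suc i < i'" using less by simp
        moreover from this have "(Suc i, j) \<in> diagram lam"
          using mem_diagram_mono[OF lam i'j, of "Suc i" j] by simp
        ultimately have "T (i, j) < T (Suc i, j)" "T (Suc i, j) < T (i', j)"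
          using semistandardD(4)[OF T] ij i'j by blast+
        then show False using eq by simp
      qed
      have "j < row_count lam T (Suc a) (Suc i)"
        using row_count_le_iff[OF T i'j, of "Suc a"] eq i' by simp
      then have "j < bk_row lam a T i"
        using bk_row_bounds(1)[of i] by (simp add: bk_lo_def)
      moreover have "\<not> j < row_count lam T (a - 1) i"
        using row_count_le_iff[OF T ij, of "a - 1"] eq a by linarith
      then have "\<not> j < bk_row lam a T i'"
        using bk_row_bounds(2)[of i'] by (simp add: bk_hi_def i')
      ultimately show ?thesis using ij i'j eq by (simp add: bender_knuth_def)
    qed
    then show ?thesis
      using lt ij i'j by (cases "T (i, j) = a \<and> T (i', j) = Suc a") (auto simp: bender_knuth_def)
  qed
qed

text \<open>At every level other than \<open>a\<close>, the entries \<open>a\<close> and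
  \<open>Suc a\<close> lie on the same side, so exchanging them moves only level \<open>a\<close> of
  the pattern.\<close>

lemma row_count_bender_knuth:
  "row_count lam (bender_knuth lam a T) k r = (if k = a then bk_row lam a T r else row_count lam T k r)"
proof (cases "k = a")
  case True
  have "row_count lam (bender_knuth lam a T) a r = bk_row lam a T r"
  proof (rule row_count_eqI)
    fix j assume rj: "(r, j) \<in> diagram lam"
    have "j < bk_row lam a T r" if "T (r, j) < a"
      using row_count_le_iff[OF T rj, of "a - 1"] bk_row_between(1)[of r] that by linarith
    moreover have "T (r, j) \<le> Suc a" if "j < bk_row lam a T r"
      using row_count_le_iff[OF T rj, of "Suc a"] bk_row_between(2)[of r] that by linarith
    ultimately show "bender_knuth lam a T (r, j) \<le> a \<longleftrightarrow> j < bk_row lam a T r"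
      using rj by (auto simp: bender_knuth_def)
  next
    fix j assume "j < bk_row lam a T r"
    then have "j < row_count lam T (Suc a) r" using bk_row_between(2)[of r] by simp
    then show "(r, j) \<in> diagram lam" by (rule row_count_mem_diagram)
  qed
  then show ?thesis using True by simp
next
  case False
  have "bender_knuth lam a T (r, j) \<le> k \<longleftrightarrow> T (r, j) \<le> k" if "(r, j) \<in> diagram lam" for j
    using that False by (auto simp: bender_knuth_def)
  then have "{j. (r, j) \<in> diagram lam \<and> bender_knuth lam a T (r, j) \<le> k} =
      {j. (r, j) \<in> diagram lam \<and> T (r, j) \<le> k}" by blast
  then show ?thesis using False by (simp add: row_count_def del: mem_diagram)
qed

lemma bender_knuth_involution: "bender_knuth lam a (bender_knuth lam a T) = T"
proof (rule extensionalityI)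
  show "bender_knuth lam a (bender_knuth lam a T) \<in> extensional (diagram lam)"
    by (simp add: bender_knuth_def)
  show "T \<in> extensional (diagram lam)" by (rule semistandardD(1)[OF T])
  \<comment> \<open>The bounds read only the levels \<open>a - 1\<close> and \<open>Suc a\<close>,
    which stay fixed, so the second application reflects in the same intervals.\<close>
  have lo: "bk_lo lam a (bender_knuth lam a T) = bk_lo lam a T"
    and hi: "bk_hi lam a (bender_knuth lam a T) = bk_hi lam a T"
    using a by (auto simp: bk_lo_def bk_hi_def row_count_bender_knuth fun_eq_iff split: nat.split)
  have row: "bk_row lam a (bender_knuth lam a T) r = row_count lam T a r" for r
    using bk_bounds[of r] by (simp add: bk_row_def lo hi row_count_bender_knuth)
  fix c assume c: "c \<in> diagram lam"
  obtain r j where rj: "c = (r, j)" by (cases c)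
  show "bender_knuth lam a (bender_knuth lam a T) c = T c"
  proof (cases "T c = a \<or> T c = Suc a")
    case True
    then have "bender_knuth lam a T c = a \<or> bender_knuth lam a T c = Suc a"
      using c by (simp add: bender_knuth_def)
    then have "bender_knuth lam a (bender_knuth lam a T) c = (if j < row_count lam T a r then a else Suc a)"
      using c by (subst bender_knuth_def) (simp add: row rj)
    then show ?thesis
      using row_count_le_iff[OF T, of r j a] c True unfolding rj by auto
  next
    case False
    then have "bender_knuth lam a T c = T c"
      using c by (simp add: bender_knuth_def)
    then show ?thesis
      using c False by (subst bender_knuth_def) simp
  qed
qed

lemma sum_bk_row:
  "(\<Sum>r<length lam. bk_row lam a T r) + (\<Sum>r<length lam. row_count lam T a r) =
     (\<Sum>r<length lam. row_count lam T (a - 1) r) + (\<Sum>r<length lam. row_count lam T (Suc a) r)"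
proof -
  let ?nu = "row_count lam T (a - 1)" and ?la = "row_count lam T (Suc a)"
  \<comment> \<open>Telescoping: the lower bound of a row and the upper bound of the next are the
    max and min of one pair, so together they add up to that pair. The extra terms belong to the
    unpaired bound at row \<open>L\<close>; they vanish at \<open>L = length lam\<close>.\<close>
  have "(\<Sum>r<L. bk_lo lam a T r + bk_hi lam a T r) + min (?la L) (if L = 0 then 0 else ?nu (L - 1)) =
      (\<Sum>r<L. ?nu r) + (\<Sum>r<L. ?la r) + (if L = 0 then 0 else ?la L)" for L
  proof (induction L)
    case (Suc L)
    have "bk_hi lam a T L + (if L = 0 then 0 else ?la L) =
        min (?la L) (if L = 0 then 0 else ?nu (L - 1)) + ?la L"
      by (auto simp: bk_hi_def split: nat.split)
    moreover have "bk_lo lam a T L + min (?la (Suc L)) (?nu L) = ?nu L + ?la (Suc L)"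
      by (simp add: bk_lo_def max_def min_def)
    ultimately show ?case using Suc by simp
  qed (simp add: bk_lo_def)
  from this[of "length lam"]
  have "(\<Sum>r<length lam. bk_lo lam a T r + bk_hi lam a T r) = (\<Sum>r<length lam. ?nu r) + (\<Sum>r<length lam. ?la r)"
    using row_count_le[of lam T "Suc a" "length lam"] by auto
  moreover have "bk_row lam a T r + row_count lam T a r = bk_lo lam a T r + bk_hi lam a T r" for r
    using bk_bounds[of r] by (simp add: bk_row_def)
  ultimately show ?thesis by (simp add: sum.distrib[symmetric])
qed

lemma content_bender_knuth:
  "content (bender_knuth lam a T) (diagram lam) =
     image_mset (transpose a (Suc a)) (content T (diagram lam))"
proof (rule multiset_eqI)
  fix x
  let ?T' = "bender_knuth lam a T"
  have transp: "count (image_mset (transpose a (Suc a)) m) x = count m (transpose a (Suc a) x)" for m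
    by (induction m) (auto simp: transpose_def)
  show "count (content ?T' (diagram lam)) x =
      count (image_mset (transpose a (Suc a)) (content T (diagram lam))) x"
  proof (cases "x = a \<or> x = Suc a")
    case True
    have "count (content T (diagram lam)) a + (\<Sum>r<length lam. row_count lam T (a - 1) r) =
        (\<Sum>r<length lam. row_count lam T a r)"
      using count_content_row_count[of T lam "a - 1"] a by simp
    moreover have "count (content ?T' (diagram lam)) a + (\<Sum>r<length lam. row_count lam T (a - 1) r) =
        (\<Sum>r<length lam. bk_row lam a T r)"
      using count_content_row_count[of ?T' lam "a - 1"] a
      by (simp add: row_count_bender_knuth less_imp_neq)
    ultimately show ?thesis
      using True count_content_row_count[of T lam a] count_content_row_count[of ?T' lam a] sum_bk_row
      unfolding transp by (auto simp: row_count_bender_knuth)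
  next
    case False
    have "{c \<in> diagram lam. ?T' c = x} = {c \<in> diagram lam. T c = x}"
      using False by (auto simp: bender_knuth_def)
    then show ?thesis using False unfolding transp
      by (simp add: count_content transpose_def)
  qed
qed

end

text \<open>The Bender--Knuth map is injective, being its own inverse. An inequality is enough:
  applied to the swapped monomial it gives the reverse one.\<close>

lemma schur_swap_le:
  assumes "lam \<in> partitions" "1 \<le> a"
  shows "schur lam m \<le> schur lam (image_mset (transpose a (Suc a)) m)"
proof -
  let ?K = "\<lambda>m. {T \<in> semistandard_tableaux lam. content T (diagram lam) = m}"
  have "card (?K m) \<le> card (?K (image_mset (transpose a (Suc a)) m))"
  proof (rule card_inj_on_le)
    show "inj_on (bender_knuth lam a) (?K m)"
      by (rule inj_on_inverseI[of _ "bender_knuth lam a"]) (use assms bender_knuth_involution in blast)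
    show "bender_knuth lam a ` ?K m \<subseteq> ?K (image_mset (transpose a (Suc a)) m)"
      using assms by (auto simp: bender_knuth_semistandard content_bender_knuth)
    show "finite (?K (image_mset (transpose a (Suc a)) m))"
      using semistandard_subset by (intro finite_content_fibre) auto
  qed
  then show ?thesis by (simp add: schur_eq_enumerator enumerator_def)
qed

lemma schur_symmetric:
  assumes "lam \<in> partitions"
  shows "schur lam \<in> symmetric_series (sum_list lam)"
  unfolding symmetric_series_def
proof (intro CollectI conjI allI impI)
  fix m assume "schur lam m \<noteq> 0"
  then obtain T where T: "T \<in> semistandard_tableaux lam" "content T (diagram lam) = m"
    by (rule schur_nonzeroD)
  show "0 \<notin># m"
    using semistandardD(2)[OF T(1)] by (force simp: T(2)[symmetric])
  show "size m = sum_list lam" by (simp add: T(2)[symmetric] card_diagram)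
next
  fix m and a :: nat assume "a \<ge> 1"
  moreover have "image_mset (transpose a (Suc a)) (image_mset (transpose a (Suc a)) m) = m"
    by (simp add: multiset.map_comp)
  ultimately show "schur lam (image_mset (transpose a (Suc a)) m) = schur lam m"
    using schur_swap_le[OF assms] by (metis order_antisym)
qed

text \<open>Elimination along the triangularity: subtract the combination of Schur functions that
  matches the coefficients at weight \<open>t\<close>, then pass to \<open>Suc t\<close>.\<close>

lemma symmetric_series_span:
  assumes "F \<in> symmetric_series n"
  shows "F \<in> series.span (schur ` partitions)"
proof -
  have "F \<in> series.span (schur ` partitions)"
    if "F \<in> symmetric_series n"
      and "\<And>lam. lam \<in> partitions \<Longrightarrow> row_weight lam < t \<Longrightarrow> F (row_content lam) = 0" for t F
    using that
  proof (induction "Suc (n * n) - t" arbitrary: t F)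
    \<comment> \<open>Here \<open>t\<close> exceeds \<open>n * n\<close>, and by
      \<open>row_weight_bound\<close> all partitions of \<open>n\<close> weigh less than
      \<open>t\<close>.\<close>
    case 0
    have "F (row_content lam) = 0" if "lam \<in> partitions" for lam
    proof (cases "sum_list lam = n")
      case True
      then show ?thesis using row_weight_bound[OF that] 0 that by auto
    next
      case False
      then show ?thesis
        using 0(2) size_row_content[of lam] by (auto simp: symmetric_series_def)
    qed
    then have "F = 0"
      using symmetric_series_eq_0[OF 0(2)] by auto
    then show ?case by (metis series.span_zero)
  next
    case (Suc k)
    define P where "P = {lam \<in> partitions. sum_list lam = n \<and> row_weight lam = t}"
    have finP: "finite P" using finite_partitions_of[of n] by (rule rev_finite_subset) (auto simp: P_def)
    define S where "S = (\<Sum>lam\<in>P. scale_series (F (row_content lam)) (schur lam))"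
    have S_span: "S \<in> series.span (schur ` partitions)"
      unfolding S_def by (intro series.span_sum series.span_scale series.span_base) (auto simp: P_def)
    have S_sym: "S \<in> symmetric_series n"
      unfolding S_def using schur_symmetric
      by (intro series.subspace_sum[OF subspace_symmetric_series]
          series.subspace_scale[OF subspace_symmetric_series]) (auto simp: P_def)
    \<comment> \<open>Up to weight \<open>t\<close>, a Schur function of weight \<open>t\<close>
      meets no leading monomial but its own, so subtracting \<open>S\<close> creates no new
      coefficient there.\<close>
    have S_eq: "S (row_content mu) = (if mu \<in> P then F (row_content mu) else 0)"
      if mu: "mu \<in> partitions" "row_weight mu \<le> t" for mu
    proof -
      have "F (row_content lam) * schur lam (row_content mu) =
          (if lam = mu then F (row_content mu) else 0)" if "lam \<in> P" for lam
        using schur_row_content_less[of lam mu] schur_row_content_self mu that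
        by (auto simp: P_def)
      then have "S (row_content mu) = (\<Sum>lam\<in>P. if lam = mu then F (row_content mu) else 0)"
        unfolding S_def sum_fun_apply scale_series_apply by (intro sum.cong) auto
      then show ?thesis using finP by simp
    qed
    have "F - S \<in> series.span (schur ` partitions)"
    proof (rule Suc(1))
      show "k = Suc (n * n) - Suc t" using Suc(2) by simp
      show "F - S \<in> symmetric_series n"
        using Suc(3) S_sym by (rule series.subspace_diff[OF subspace_symmetric_series])
      fix mu assume mu: "mu \<in> partitions" "row_weight mu < Suc t"
      show "(F - S) (row_content mu) = 0"
      proof (cases "mu \<in> P")
        case True
        then show ?thesis using S_eq[of mu] mu by simp
      next
        case False
        have "F (row_content mu) = 0"
        proof (cases "row_weight mu = t")
          case True
          then have "size (row_content mu) \<noteq> n" using False mu by (simp add: P_def)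
          then show ?thesis using Suc(3) by (auto simp: symmetric_series_def)
        qed (use Suc(4) mu in auto)
        then show ?thesis using S_eq[of mu] mu False by simp
      qed
    qed
    then have "(F - S) + S \<in> series.span (schur ` partitions)"
      using S_span by (rule series.span_add)
    moreover have "(F - S) + S = F" by (rule diff_add_cancel)
    ultimately show ?case by metis
  qed
  from this[of F 0] show ?thesis using assms by simp
qed

subsection \<open>The coefficient of the column\<close>

text \<open>Ordered set partitions of \<open>A\<close>: the colour classes are the blocks, in the
  order of their colours.\<close>

definition packed :: "'a set \<Rightarrow> ('a \<Rightarrow> nat) set" where
  "packed A = {\<kappa> \<in> A \<rightarrow>\<^sub>E UNIV. \<exists>l. \<kappa> ` A = {1..l}}"

text \<open>The sum in the exponent has the parity of the difference of points and blocks and avoids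
  subtraction on naturals.\<close>

definition packed_sign :: "'a set \<Rightarrow> ('a \<Rightarrow> nat) \<Rightarrow> rat" where
  "packed_sign A \<kappa> = (- 1) ^ (card A + card (\<kappa> ` A))"

definition packed_multisets :: "nat \<Rightarrow> nat multiset set" where
  "packed_multisets n = {m. size m = n \<and> (\<exists>l. set_mset m = {1..l})}"

text \<open>
  In terms of the Hall inner product this is \<open>\<langle>F, e\<^sub>n\<rangle>\<close>, written through
  \<open>e\<^sub>n = \<Sum> (-1)\<^sup>n\<^sup>-\<^sup>l h\<^sub>\<alpha>\<close> over all compositions \<open>\<alpha>\<close> of \<open>n\<close> into \<open>l\<close> parts.
\<close>

definition alternating_coeff :: "nat \<Rightarrow> power_series \<Rightarrow> rat" where
  "alternating_coeff n F = (\<Sum>m\<in>packed_multisets n. (- 1) ^ (n + card (set_mset m)) * F m)"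

lemma packed_values_le:
  assumes "finite A" "\<kappa> ` A = {1..l}"
  shows "l \<le> card A"
  using card_image_le[OF assms(1), of \<kappa>] assms(2) by simp

lemma finite_packed: "finite A \<Longrightarrow> finite (packed A)"
proof (rule finite_subset)
  assume A: "finite A"
  show "packed A \<subseteq> A \<rightarrow>\<^sub>E {..card A}"
  proof
    fix \<kappa> assume "\<kappa> \<in> packed A"
    then obtain l where \<kappa>: "\<kappa> \<in> A \<rightarrow>\<^sub>E UNIV" "\<kappa> ` A = {1..l}" unfolding packed_def by blast
    then have "\<kappa> x \<in> {1..l}" if "x \<in> A" for x using that by blast
    then show "\<kappa> \<in> A \<rightarrow>\<^sub>E {..card A}"
      using \<kappa>(1) packed_values_le[OF A \<kappa>(2)] by (fastforce simp: PiE_iff)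
  qed
  show "finite (A \<rightarrow>\<^sub>E {..card A})" using A by (intro finite_PiE) auto
qed

lemma finite_packed_multisets: "finite (packed_multisets n)"
proof (rule finite_surj)
  show "finite {xs. set xs \<subseteq> {..n} \<and> length xs = n}" by (rule finite_lists_length_eq) simp
  show "packed_multisets n \<subseteq> mset ` {xs. set xs \<subseteq> {..n} \<and> length xs = n}"
  proof
    fix m assume "m \<in> packed_multisets n"
    then obtain l where m: "size m = n" "set_mset m = {1..l}" unfolding packed_multisets_def by blast
    obtain xs where xs: "mset xs = m" using ex_mset by blast
    have "set xs = {1..l}" using m(2) xs by (metis set_mset_mset)
    moreover from this have "l \<le> length xs" using card_length[of xs] by simp
    moreover have "length xs = n" using m(1) xs by (metis size_mset)
    ultimately show "m \<in> mset ` {xs. set xs \<subseteq> {..n} \<and> length xs = n}"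
      using xs by (intro image_eqI[of _ _ xs]) auto
  qed
qed

lemma alternating_coeff_enumerator:
  assumes A: "finite A" and K: "K \<subseteq> A \<rightarrow>\<^sub>E UNIV"
  shows "alternating_coeff (card A) (enumerator A K) = (\<Sum>\<kappa>\<in>K \<inter> packed A. packed_sign A \<kappa>)"
proof -
  have "(- 1) ^ (card A + card (set_mset m)) * enumerator A K m =
      (\<Sum>\<kappa>\<in>{\<kappa> \<in> K \<inter> packed A. content \<kappa> A = m}. packed_sign A \<kappa>)"
    if m: "m \<in> packed_multisets (card A)" for m
  proof -
    \<comment> \<open>The content alone decides whether a map is packed; it also fixes the
      sign.\<close>
    have eq: "{\<kappa> \<in> K \<inter> packed A. content \<kappa> A = m} = {\<kappa> \<in> K. content \<kappa> A = m}"
      using K A m by (auto simp: packed_def packed_multisets_def)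
    have "(\<Sum>\<kappa>\<in>{\<kappa> \<in> K. content \<kappa> A = m}. packed_sign A \<kappa>) =
        (\<Sum>\<kappa>\<in>{\<kappa> \<in> K. content \<kappa> A = m}. (- 1) ^ (card A + card (set_mset m)))"
      using A by (intro sum.cong) (auto simp: packed_sign_def)
    then show ?thesis unfolding eq by (simp add: enumerator_def)
  qed
  then have "alternating_coeff (card A) (enumerator A K) =
      (\<Sum>m\<in>packed_multisets (card A). \<Sum>\<kappa>\<in>{\<kappa> \<in> K \<inter> packed A. content \<kappa> A = m}. packed_sign A \<kappa>)"
    unfolding alternating_coeff_def by (intro sum.cong) auto
  also have "\<dots> = (\<Sum>\<kappa>\<in>K \<inter> packed A. packed_sign A \<kappa>)"
    using A by (intro sum.group finite_Int disjI2 finite_packed finite_packed_multisets)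
      (auto simp: packed_def packed_multisets_def)
  finally show ?thesis .
qed

lemma alternating_coeff_add: "alternating_coeff n (F + G) = alternating_coeff n F + alternating_coeff n G"
  by (simp add: alternating_coeff_def algebra_simps sum.distrib)

lemma alternating_coeff_scale: "alternating_coeff n (scale_series c F) = c * alternating_coeff n F"
  by (simp add: alternating_coeff_def scale_series_def sum_distrib_left mult.left_commute)

subsection \<open>Splitting and merging colour classes\<close>

definition alone :: "'a set \<Rightarrow> 'a \<Rightarrow> ('a \<Rightarrow> nat) \<Rightarrow> bool" where
  "alone A p \<kappa> \<longleftrightarrow> (\<forall>q\<in>A. \<kappa> q = \<kappa> p \<longrightarrow> q = p)"

text \<open>The point \<open>p\<close> becomes a block of its own, placed just before the rest of
  its former block.\<close>

definition split_at :: "'a set \<Rightarrow> 'a \<Rightarrow> ('a \<Rightarrow> nat) \<Rightarrow> 'a \<Rightarrow> nat" where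
  "split_at A p \<kappa> = (\<lambda>x\<in>A. if \<kappa> p \<le> \<kappa> x \<and> x \<noteq> p then Suc (\<kappa> x) else \<kappa> x)"

text \<open>On a packed map with \<open>p\<close> alone and not in the last block, this joins
  \<open>p\<close> to the next higher block.\<close>

definition merge_at :: "'a set \<Rightarrow> 'a \<Rightarrow> ('a \<Rightarrow> nat) \<Rightarrow> 'a \<Rightarrow> nat" where
  "merge_at A p \<kappa> = (\<lambda>x\<in>A. if \<kappa> p < \<kappa> x then \<kappa> x - 1 else \<kappa> x)"

lemma split_at:
  assumes p: "p \<in> A" and \<kappa>: "\<kappa> \<in> packed A" and not_alone: "\<not> alone A p \<kappa>"
  shows "split_at A p \<kappa> \<in> packed A"
    and "card (split_at A p \<kappa> ` A) = Suc (card (\<kappa> ` A))"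
    and "alone A p (split_at A p \<kappa>)"
    and "\<exists>q\<in>A. split_at A p \<kappa> p < split_at A p \<kappa> q"
    and "merge_at A p (split_at A p \<kappa>) = \<kappa>"
proof -
  let ?s = "split_at A p \<kappa>"
  obtain l where l: "\<kappa> ` A = {1..l}" using \<kappa> unfolding packed_def by blast
  obtain q where q: "q \<in> A" "\<kappa> q = \<kappa> p" "q \<noteq> p" using not_alone by (auto simp: alone_def)
  have s: "?s x = (if \<kappa> p \<le> \<kappa> x \<and> x \<noteq> p then Suc (\<kappa> x) else \<kappa> x)" if "x \<in> A" for x
    using that by (simp add: split_at_def)
  have "?s ` A = {1..Suc l}"
  proof (intro equalityI subsetI)
    fix y assume "y \<in> ?s ` A"
    then obtain x where x: "x \<in> A" "y = ?s x" by auto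
    then have "\<kappa> x \<in> {1..l}" using l by blast
    then show "y \<in> {1..Suc l}" using x s by auto
  next
    fix y assume y: "y \<in> {1..Suc l}"
    have pl: "\<kappa> p \<in> {1..l}" using p l by blast
    \<comment> \<open>Colour \<open>Suc (\<kappa> p)\<close> is where the former classmates of
      \<open>p\<close> land; \<open>q\<close> shows that this class is inhabited.\<close>
    consider "y < \<kappa> p" | "y = \<kappa> p" | "y = Suc (\<kappa> p)" | "Suc (\<kappa> p) < y" by linarith
    then show "y \<in> ?s ` A"
    proof cases
      case 1
      then have "y \<in> \<kappa> ` A" using y pl l by auto
      then obtain x where "x \<in> A" "\<kappa> x = y" by auto
      then show ?thesis using 1 s[of x] by (intro image_eqI[of _ _ x]) auto
    next
      case 2
      then show ?thesis using p s[of p] by (intro image_eqI[of _ _ p]) auto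
    next
      case 3
      then show ?thesis using q s[of q] by (intro image_eqI[of _ _ q]) auto
    next
      case 4
      then have "y - 1 \<in> \<kappa> ` A" using y l by auto
      then obtain x where "x \<in> A" "\<kappa> x = y - 1" by auto
      then show ?thesis using 4 s[of x] by (intro image_eqI[of _ _ x]) auto
    qed
  qed
  then show "?s \<in> packed A" "card (?s ` A) = Suc (card (\<kappa> ` A))"
    using l by (auto simp: packed_def split_at_def)
  show "alone A p ?s" using p by (auto simp: alone_def s split: if_splits)
  show "\<exists>q\<in>A. ?s p < ?s q" using q p by (intro bexI[of _ q]) (auto simp: s)
  have ext: "\<kappa> \<in> extensional A" using \<kappa> by (auto simp: packed_def PiE_iff)
  show "merge_at A p ?s = \<kappa>"
  proof (rule extensionalityI[OF _ ext])
    show "merge_at A p ?s \<in> extensional A" by (simp add: merge_at_def)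
    show "merge_at A p ?s x = \<kappa> x" if "x \<in> A" for x
      using that p by (auto simp: merge_at_def s)
  qed
qed

lemma merge_at:
  assumes p: "p \<in> A" and \<kappa>: "\<kappa> \<in> packed A" and alone: "alone A p \<kappa>"
    and greater: "\<exists>q\<in>A. \<kappa> p < \<kappa> q"
  shows "merge_at A p \<kappa> \<in> packed A"
    and "\<not> alone A p (merge_at A p \<kappa>)"
    and "split_at A p (merge_at A p \<kappa>) = \<kappa>"
proof -
  let ?m = "merge_at A p \<kappa>"
  obtain l where l: "\<kappa> ` A = {1..l}" using \<kappa> unfolding packed_def by blast
  have m: "?m x = (if \<kappa> p < \<kappa> x then \<kappa> x - 1 else \<kappa> x)" if "x \<in> A" for x
    using that by (simp add: merge_at_def)
  have pl: "1 \<le> \<kappa> p" using p l by fastforce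
  obtain q where q: "q \<in> A" "\<kappa> p < \<kappa> q" using greater by blast
  then have pl': "\<kappa> p < l" using l by (metis atLeastAtMost_iff imageI less_le_trans)
  have "?m ` A = {1..l - 1}"
  proof (intro equalityI subsetI)
    fix y assume "y \<in> ?m ` A"
    then obtain x where x: "x \<in> A" "y = ?m x" by auto
    then have "\<kappa> x \<in> {1..l}" using l by blast
    then show "y \<in> {1..l - 1}" using x m[of x] pl pl' by (auto split: if_splits)
  next
    fix y assume y: "y \<in> {1..l - 1}"
    define z where "z = (if y \<le> \<kappa> p then y else Suc y)"
    have "z \<in> \<kappa> ` A" using y l by (auto simp: z_def)
    then obtain x where "x \<in> A" "\<kappa> x = z" by auto
    then show "y \<in> ?m ` A" using m[of x] by (intro image_eqI[of _ _ x]) (auto simp: z_def)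
  qed
  then show "?m \<in> packed A" by (auto simp: packed_def merge_at_def)
  \<comment> \<open>Colours have no gaps, so the next class is inhabited and its members become
    classmates of \<open>p\<close>.\<close>
  have "Suc (\<kappa> p) \<in> \<kappa> ` A" using pl' l by auto
  then obtain x where "x \<in> A" "\<kappa> x = Suc (\<kappa> p)" by (metis imageE)
  then show "\<not> alone A p ?m" using p m by (auto simp: alone_def intro!: bexI[of _ x])
  have ext: "\<kappa> \<in> extensional A" using \<kappa> by (auto simp: packed_def PiE_iff)
  show "split_at A p ?m = \<kappa>"
  proof (rule extensionalityI[OF _ ext])
    show "split_at A p ?m \<in> extensional A" by (simp add: split_at_def)
    show "split_at A p ?m x = \<kappa> x" if "x \<in> A" for x
      using that p alone by (auto simp: split_at_def m alone_def)
  qed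
qed

text \<open>A sign-reversing involution: splitting and merging pair the maps with \<open>p\<close>
  alone with the others and change the number of blocks by one. The condition on larger colours
  provides a block to merge into.\<close>

lemma sum_packed_sign_cancel:
  assumes A: "finite A" and p: "p \<in> A" and K: "K \<subseteq> packed A"
    and split: "\<And>\<kappa>. \<kappa> \<in> K \<Longrightarrow> \<not> alone A p \<kappa> \<Longrightarrow> split_at A p \<kappa> \<in> K"
    and greater: "\<And>\<kappa>. \<kappa> \<in> K \<Longrightarrow> alone A p \<kappa> \<Longrightarrow> \<exists>q\<in>A. \<kappa> p < \<kappa> q"
    and merge: "\<And>\<kappa>. \<kappa> \<in> K \<Longrightarrow> alone A p \<kappa> \<Longrightarrow> merge_at A p \<kappa> \<in> K"
  shows "(\<Sum>\<kappa>\<in>K. packed_sign A \<kappa>) = 0"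
proof -
  have finK: "finite K" using finite_subset[OF K finite_packed[OF A]] .
  have "(\<Sum>\<kappa>\<in>{\<kappa> \<in> K. \<not> alone A p \<kappa>}. - packed_sign A \<kappa>) = (\<Sum>\<kappa>\<in>{\<kappa> \<in> K. alone A p \<kappa>}. packed_sign A \<kappa>)"
  proof (rule sum.reindex_bij_witness[of _ "merge_at A p" "split_at A p"])
    fix \<kappa> assume *: "\<kappa> \<in> {\<kappa> \<in> K. \<not> alone A p \<kappa>}"
    then have \<kappa>: "\<kappa> \<in> packed A" "\<not> alone A p \<kappa>" using K by auto
    show "merge_at A p (split_at A p \<kappa>) = \<kappa>" by (rule split_at(5)[OF p \<kappa>])
    show "split_at A p \<kappa> \<in> {\<kappa> \<in> K. alone A p \<kappa>}" using * split split_at(3)[OF p \<kappa>] by simp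
    show "packed_sign A (split_at A p \<kappa>) = - packed_sign A \<kappa>"
      by (simp add: packed_sign_def split_at(2)[OF p \<kappa>])
  next
    fix \<kappa> assume *: "\<kappa> \<in> {\<kappa> \<in> K. alone A p \<kappa>}"
    then have \<kappa>: "\<kappa> \<in> packed A" "alone A p \<kappa>" "\<exists>q\<in>A. \<kappa> p < \<kappa> q" using K greater by auto
    show "split_at A p (merge_at A p \<kappa>) = \<kappa>" by (rule merge_at(3)[OF p \<kappa>])
    show "merge_at A p \<kappa> \<in> {\<kappa> \<in> K. \<not> alone A p \<kappa>}" using * merge merge_at(2)[OF p \<kappa>] by simp
  qed
  moreover have "(\<Sum>\<kappa>\<in>K. packed_sign A \<kappa>) =
      (\<Sum>\<kappa>\<in>{\<kappa> \<in> K. alone A p \<kappa>}. packed_sign A \<kappa>) + (\<Sum>\<kappa>\<in>{\<kappa> \<in> K. \<not> alone A p \<kappa>}. packed_sign A \<kappa>)"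
    using finK by (subst sum.union_disjoint[symmetric]) (auto intro!: sum.cong)
  ultimately show ?thesis by (simp add: sum_negf)
qed

section \<open>Values of the column functional on Schur functions\<close>

lemma alternating_coeff_schur_column:
  "alternating_coeff n (schur (replicate n 1)) = 1"
proof -
  let ?mu = "replicate n (1 :: nat)"
  have part: "?mu \<in> partitions" by (auto simp: partitions_def sorted_wrt_iff_nth_less)
  have set: "set_mset (row_content ?mu) = {1..n}"
  proof -
    have "diagram ?mu = {..<n} \<times> {0}" by (auto simp: diagram_def)
    then have "set_mset (row_content ?mu) = Suc ` fst ` ({..<n} \<times> {0 :: nat})"
      unfolding row_content_def set_mset_content[OF finite_diagram] by (simp only: image_image)
    then show ?thesis using image_Suc_lessThan[of n] by simp
  qed
  have mem: "row_content ?mu \<in> packed_multisets n"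
    using set by (auto simp: packed_multisets_def sum_list_replicate)
  have zero: "schur ?mu m = 0" if m: "m \<in> packed_multisets n - {row_content ?mu}" for m
  proof (rule ccontr)
    assume "schur ?mu m \<noteq> 0"
    then obtain T where T: "T \<in> semistandard_tableaux ?mu" "content T (diagram ?mu) = m"
      by (rule schur_nonzeroD)
    obtain l where l: "set_mset m = {1..l}" using m unfolding packed_multisets_def by blast
    \<comment> \<open>A strictly increasing column has distinct entries, so a content without gaps
      must be \<open>{1..n}\<close>, each value once.\<close>
    have inj: "inj_on T (diagram ?mu)"
    proof (rule inj_onI, clarify)
      fix i j i' j' assume *: "(i, j) \<in> diagram ?mu" "(i', j') \<in> diagram ?mu" "T (i, j) = T (i', j')"
      then have "j = 0" "j' = 0" by auto
      then show "i = i' \<and> j = j'"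
        using semistandardD(4)[OF T(1), of i 0 i'] semistandardD(4)[OF T(1), of i' 0 i] *
        by (cases i i' rule: linorder_cases) auto
    qed
    have "m = mset_set {1..l}"
      using inj l by (simp add: T(2)[symmetric] content_def image_mset_mset_set)
    moreover have "l = n" using that calculation by (auto simp: packed_multisets_def)
    ultimately have "m = row_content ?mu"
      by (auto simp: multiset_eq_iff count_row_content)
    then show False using that by simp
  qed
  have "alternating_coeff n (schur ?mu) =
      (\<Sum>m\<in>{row_content ?mu}. (- 1) ^ (n + card (set_mset m)) * schur ?mu m)"
    unfolding alternating_coeff_def
    using mem zero by (intro sum.mono_neutral_right[OF finite_packed_multisets]) auto
  also have "\<dots> = 1" using set schur_row_content_self[OF part] by (simp flip: mult_2)
  finally show ?thesis .
qed

text \<open>The cell is leftmost in its row, so keeping its entry while raising the other equal or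
  larger ones harms no row. In its column the entries above are smaller and those below larger, so
  strictness survives too.\<close>

lemma split_at_semistandard:
  assumes T: "T \<in> semistandard_tableaux lam" and r: "(r, 0) \<in> diagram lam"
  shows "split_at (diagram lam) (r, 0) T \<in> semistandard_tableaux lam"
proof (rule semistandardI)
  show "split_at (diagram lam) (r, 0) T \<in> extensional (diagram lam)" by (simp add: split_at_def)
  show "1 \<le> split_at (diagram lam) (r, 0) T (i, j)" if "(i, j) \<in> diagram lam" for i j
    using semistandardD(2)[OF T that] that by (auto simp: split_at_def)
  show "split_at (diagram lam) (r, 0) T (i, j) \<le> split_at (diagram lam) (r, 0) T (i, j')"
    if "(i, j) \<in> diagram lam" "(i, j') \<in> diagram lam" "j < j'" for i j j'
    using semistandardD(3)[OF T that(1,2)] that by (auto simp: split_at_def simp del: mem_diagram)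
  show "split_at (diagram lam) (r, 0) T (i, j) < split_at (diagram lam) (r, 0) T (i', j)"
    if "(i, j) \<in> diagram lam" "(i', j) \<in> diagram lam" "i < i'" for i i' j
    using semistandardD(4)[OF T that] that by (auto simp: split_at_def simp del: mem_diagram)
qed

text \<open>Within a column, lowering can only collapse an entry equal to \<open>T (r, 0)\<close>
  with one larger by 1. As the cell is alone, the former would be the cell itself, and
  \<open>gap\<close> rules out the latter.\<close>

lemma merge_at_semistandard:
  assumes T: "T \<in> semistandard_tableaux lam" and r: "(r, 0) \<in> diagram lam"
    and alone: "alone (diagram lam) (r, 0) T"
    and gap: "\<And>i. r < i \<Longrightarrow> (i, 0) \<in> diagram lam \<Longrightarrow> Suc (T (r, 0)) < T (i, 0)"
  shows "merge_at (diagram lam) (r, 0) T \<in> semistandard_tableaux lam"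
proof (rule semistandardI)
  show "merge_at (diagram lam) (r, 0) T \<in> extensional (diagram lam)" by (simp add: merge_at_def)
  show "1 \<le> merge_at (diagram lam) (r, 0) T (i, j)" if "(i, j) \<in> diagram lam" for i j
    using semistandardD(2)[OF T that] semistandardD(2)[OF T r] that
    by (auto simp: merge_at_def simp del: mem_diagram)
  show "merge_at (diagram lam) (r, 0) T (i, j) \<le> merge_at (diagram lam) (r, 0) T (i, j')"
    if "(i, j) \<in> diagram lam" "(i, j') \<in> diagram lam" "j < j'" for i j j'
    using semistandardD(3)[OF T that(1,2)] that by (auto simp: merge_at_def simp del: mem_diagram)
  show "merge_at (diagram lam) (r, 0) T (i, j) < merge_at (diagram lam) (r, 0) T (i', j)"
    if ij: "(i, j) \<in> diagram lam" "(i', j) \<in> diagram lam" "i < i'" for i i' j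
  proof (cases "T (i, j) = T (r, 0)")
    case True
    then have "(i, j) = (r, 0)" using alone ij unfolding alone_def by blast
    then show ?thesis using gap[of i'] ij by (auto simp: merge_at_def simp del: mem_diagram)
  next
    case False
    then show ?thesis
      using semistandardD(4)[OF T ij] ij by (auto simp: merge_at_def simp del: mem_diagram)
  qed
qed

text \<open>
  The classes are split and merged at the lowest cell of the first column whose entry is at most
  the entry of the cell \<open>(0, 1)\<close>; every entry smaller than the latter lies in the first column.
\<close>

lemma alternating_coeff_schur_0:
  assumes lam: "lam \<in> partitions" and cell: "(0, 1) \<in> diagram lam"
  shows "alternating_coeff (sum_list lam) (schur lam) = 0"
proof -
  let ?D = "diagram lam"
  let ?K = "semistandard_tableaux lam \<inter> packed ?D"
  define R where "R T = {i. (i, 0) \<in> ?D \<and> T (i, 0) \<le> T (0, 1)}" for T :: "nat \<times> nat \<Rightarrow> nat"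
  have finR: "finite (R T)" for T by (rule finite_subset[of _ "{..<length lam}"]) (auto simp: R_def)
  have cell0: "(0, 0) \<in> ?D" using mem_diagram_mono[OF lam cell, of 0 0] by simp
  have R0: "0 \<in> R T" if "T \<in> semistandard_tableaux lam" for T
    using semistandardD(3)[OF that cell0 cell] cell0 by (simp add: R_def)
  have MaxR: "Max (R T) = r \<longleftrightarrow> (r, 0) \<in> ?D \<and> T (r, 0) \<le> T (0, 1) \<and>
      (\<forall>i>r. (i, 0) \<in> ?D \<longrightarrow> T (0, 1) < T (i, 0))" if "T \<in> semistandard_tableaux lam" for T r
  proof -
    have "Max (R T) = r \<longleftrightarrow> r \<in> R T \<and> (\<forall>i\<in>R T. i \<le> r)"
      using R0[OF that] finR by (intro Max_eq_iff) auto
    then show ?thesis by (auto simp: R_def not_le[symmetric] simp del: mem_diagram)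
  qed
  have "alternating_coeff (sum_list lam) (schur lam) = (\<Sum>T\<in>?K. packed_sign ?D T)"
    using alternating_coeff_enumerator[OF finite_diagram semistandard_subset[of lam]]
    by (simp add: card_diagram schur_eq_enumerator)
  \<comment> \<open>Cancellation works at a fixed cell, so the tableaux are grouped by the row
    \<open>Max (R T)\<close> of the distinguished cell; splitting and merging must then preserve
    this row.\<close>
  also have "\<dots> = (\<Sum>r<length lam. \<Sum>T\<in>{T \<in> ?K. Max (R T) = r}. packed_sign ?D T)"
  proof (rule sum.group[symmetric])
    show "(\<lambda>T. Max (R T)) ` ?K \<subseteq> {..<length lam}"
      using MaxR by auto
    show "finite ?K" using finite_packed[OF finite_diagram] by blast
  qed simp
  also have "\<dots> = 0"
  proof (rule sum.neutral, rule ballI)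
    fix r assume "r \<in> {..<length lam}"
    then have r: "(r, 0) \<in> ?D" using partitions_pos[OF lam] by simp
    show "(\<Sum>T\<in>{T \<in> ?K. Max (R T) = r}. packed_sign ?D T) = 0"
    proof (rule sum_packed_sign_cancel[OF finite_diagram r])
      show "{T \<in> ?K. Max (R T) = r} \<subseteq> packed ?D" by auto
    next
      fix T assume "T \<in> {T \<in> ?K. Max (R T) = r}" and na: "\<not> alone ?D (r, 0) T"
      then have T: "T \<in> semistandard_tableaux lam" "T \<in> packed ?D" "T (r, 0) \<le> T (0, 1)"
        "\<And>i. r < i \<Longrightarrow> (i, 0) \<in> ?D \<Longrightarrow> T (0, 1) < T (i, 0)"
        using MaxR by auto
      have S: "split_at ?D (r, 0) T \<in> semistandard_tableaux lam"
        by (rule split_at_semistandard[OF T(1) r])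
      have "Max (R (split_at ?D (r, 0) T)) = r"
        unfolding MaxR[OF S] using r cell T(3,4)
        by (auto simp: split_at_def simp del: mem_diagram) fastforce+
      then show "split_at ?D (r, 0) T \<in> {T \<in> ?K. Max (R T) = r}"
        using S split_at(1)[OF r T(2) na] by simp
    next
      fix T assume "T \<in> {T \<in> ?K. Max (R T) = r}" and al: "alone ?D (r, 0) T"
      then have T: "T \<in> semistandard_tableaux lam" "T \<in> packed ?D" "T (r, 0) \<le> T (0, 1)"
        "\<And>i. r < i \<Longrightarrow> (i, 0) \<in> ?D \<Longrightarrow> T (0, 1) < T (i, 0)"
        using MaxR by auto
      \<comment> \<open>Being alone, the cell cannot share the entry of \<open>(0, 1)\<close>. Since
        the entries below it exceed that entry, they are larger by at least 2, which is the gap that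
        merging requires.\<close>
      have less: "T (r, 0) < T (0, 1)"
        using T(3) al cell by (auto simp: alone_def le_less simp del: mem_diagram)
      show greater: "\<exists>q\<in>?D. T (r, 0) < T q" using less cell by blast
      have S: "merge_at ?D (r, 0) T \<in> semistandard_tableaux lam"
        using less T(4) by (intro merge_at_semistandard[OF T(1) r al]) force
      have "Max (R (merge_at ?D (r, 0) T)) = r"
        unfolding MaxR[OF S] using r cell less T(4)
        by (auto simp: merge_at_def simp del: mem_diagram) fastforce+
      then show "merge_at ?D (r, 0) T \<in> {T \<in> ?K. Max (R T) = r}"
        using S merge_at(1)[OF r T(2) al greater] by simp
    qed
  qed
  finally show ?thesis .
qed

lemma alternating_coeff_schur:
  assumes lam: "lam \<in> partitions"
  shows "alternating_coeff n (schur lam) = (if lam = replicate n 1 then 1 else 0)"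
proof (cases "sum_list lam = n")
  case False
  have "alternating_coeff n (schur lam) = 0"
    unfolding alternating_coeff_def
  proof (intro sum.neutral ballI)
    fix m assume "m \<in> packed_multisets n"
    then have "size m \<noteq> sum_list lam" using False by (simp add: packed_multisets_def)
    then have "schur lam m = 0"
      using schur_symmetric[OF lam] unfolding symmetric_series_def by blast
    then show "(- 1) ^ (n + card (set_mset m)) * schur lam m = 0" by simp
  qed
  then show ?thesis using False by (auto simp: sum_list_replicate)
next
  case n: True
  show ?thesis
  proof (cases "(0, 1) \<in> diagram lam")
    case True
    then have "lam \<noteq> replicate n 1" by auto
    then show ?thesis using alternating_coeff_schur_0[OF lam True] n by simp
  next
    case False
    have "lam ! i = 1" if "i < length lam" for i
      using False that partitions_pos[OF lam that] partitions_antimono[OF lam, of 0 i] by auto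
    then have "lam = replicate (length lam) 1" by (intro nth_equalityI) auto
    moreover from this have "length lam = n" using n by (metis sum_list_replicate mult.right_neutral of_nat_id)
    ultimately have "lam = replicate n 1" by simp
    then show ?thesis using alternating_coeff_schur_column[of n] by simp
  qed
qed

subsection \<open>Deletion and contraction\<close>

text \<open>\<open>E\<close> is an arbitrary relation because the recursion leaves simple graphs:
  contraction may create loops, and deleting a single arc breaks symmetry.\<close>

definition packed_colorings :: "'a set \<Rightarrow> 'a rel \<Rightarrow> ('a \<Rightarrow> nat) set" where
  "packed_colorings V E = {\<kappa> \<in> packed V. \<forall>(u, v)\<in>E. \<kappa> u \<noteq> \<kappa> v}"

text \<open>Splitting and merging at a fixed point \<open>p\<close> cancels all maps except those
  where \<open>p\<close> alone forms the last block; removing \<open>p\<close> from these leads to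
  the smaller set. The value 1 matches the single acyclic orientation of an edgeless graph.\<close>

lemma sum_packed_sign:
  assumes "finite V"
  shows "(\<Sum>\<kappa>\<in>packed V. packed_sign V \<kappa>) = 1"
  using assms
proof (induction V rule: finite_induct)
  case empty
  have "packed {} = {\<lambda>x :: 'a. undefined}" by (auto simp: packed_def)
  then show ?case by (simp add: packed_sign_def)
next
  case (insert p V)
  let ?A = "insert p V"
  have finA: "finite ?A" using insert by simp
  define L where "L = {\<kappa> \<in> packed ?A. alone ?A p \<kappa> \<and> (\<forall>q\<in>?A. \<kappa> q \<le> \<kappa> p)}"
  have "(\<Sum>\<kappa>\<in>packed ?A - L. packed_sign ?A \<kappa>) = 0"
  proof (rule sum_packed_sign_cancel[OF finA insertI1])
    fix \<kappa> assume *: "\<kappa> \<in> packed ?A - L"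
    show "split_at ?A p \<kappa> \<in> packed ?A - L" if "\<not> alone ?A p \<kappa>"
      using split_at(1,4)[OF insertI1 _ that] * by (fastforce simp: L_def)
    assume al: "alone ?A p \<kappa>"
    then show ex: "\<exists>q\<in>?A. \<kappa> p < \<kappa> q" using * by (auto simp: L_def not_le)
    show "merge_at ?A p \<kappa> \<in> packed ?A - L"
      using merge_at(1,2)[OF insertI1 _ al ex] * by (auto simp: L_def)
  qed auto
  \<comment> \<open>Removing \<open>p\<close> lowers both the number of points and the number of
    blocks by one, so signs agree.\<close>
  moreover have "(\<Sum>\<kappa>\<in>L. packed_sign ?A \<kappa>) = (\<Sum>\<kappa>\<in>packed V. packed_sign V \<kappa>)"
  proof (rule sum.reindex_bij_witness[of _
        "\<lambda>\<kappa>. \<lambda>x\<in>?A. if x = p then Suc (card (\<kappa> ` V)) else \<kappa> x" "\<lambda>\<kappa>. restrict \<kappa> V"])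
    fix \<kappa> assume "\<kappa> \<in> L"
    then have \<kappa>: "\<kappa> \<in> packed ?A" and al: "\<And>q. q \<in> V \<Longrightarrow> \<kappa> q < \<kappa> p"
      using insert by (fastforce simp: L_def alone_def le_less)+
    obtain l where l: "\<kappa> ` ?A = {1..l}" using \<kappa> unfolding packed_def by blast
    have "\<kappa> p \<in> {1..l}" using l by blast
    moreover have "l \<in> \<kappa> ` ?A" using l calculation by auto
    then have "l \<le> \<kappa> p" using al by (auto dest: less_imp_le)
    ultimately have pl: "\<kappa> p = l" "1 \<le> l" by auto
    have "\<kappa> p \<notin> \<kappa> ` V" using al by (metis imageE less_irrefl)
    then have "\<kappa> ` V = \<kappa> ` ?A - {\<kappa> p}" by simp
    then have "\<kappa> ` V = {1..l} - {l}" unfolding l pl(1) .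
    also have "\<dots> = {1..l - 1}" using pl(2) by auto
    finally have V: "\<kappa> ` V = {1..l - 1}" .
    show "restrict \<kappa> V \<in> packed V" using V by (auto simp: packed_def)
    have "card (\<kappa> ` V) = l - 1" using V by simp
    then show "(\<lambda>x\<in>?A. if x = p then Suc (card (restrict \<kappa> V ` V)) else restrict \<kappa> V x) = \<kappa>"
      using \<kappa> pl by (auto simp: fun_eq_iff packed_def PiE_iff extensional_def)
    show "packed_sign V (restrict \<kappa> V) = packed_sign ?A \<kappa>"
      using V l pl insert by (cases l) (simp_all add: packed_sign_def)
  next
    fix \<kappa> assume \<kappa>: "\<kappa> \<in> packed V"
    then obtain l where l: "\<kappa> ` V = {1..l}" unfolding packed_def by blast
    let ?k = "\<lambda>x\<in>?A. if x = p then Suc (card (\<kappa> ` V)) else \<kappa> x"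
    show "restrict ?k V = \<kappa>"
      using \<kappa> insert by (auto simp: fun_eq_iff packed_def PiE_iff extensional_def)
    have V: "?k ` V = {1..l}"
      unfolding l[symmetric] using insert by (intro image_cong) auto
    have "?k p = Suc l" using l by simp
    then have "?k ` ?A = insert (Suc l) {1..l}" unfolding image_insert V by (rule arg_cong)
    then have "\<exists>l. ?k ` ?A = {1..l}" by (intro exI[of _ "Suc l"]) auto
    moreover have "?k \<in> ?A \<rightarrow>\<^sub>E UNIV" by simp
    ultimately have "?k \<in> packed ?A" unfolding packed_def mem_Collect_eq by (intro conjI)
    moreover have kV: "?k q \<le> l" if "q \<in> V" for q
      using imageI[OF that, of ?k] unfolding V atLeastAtMost_iff by (rule conjunct2)
    have "alone ?A p ?k"
      unfolding alone_def
    proof (intro ballI impI)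
      fix q assume "q \<in> ?A" "?k q = ?k p"
      then have "\<not> ?k q \<le> l" unfolding \<open>?k p = Suc l\<close> by linarith
      then show "q = p" using kV[of q] \<open>q \<in> ?A\<close> by blast
    qed
    moreover have "\<forall>q\<in>?A. ?k q \<le> ?k p"
      unfolding \<open>?k p = Suc l\<close> by (intro ballI, erule insertE) (simp only: \<open>?k p = Suc l\<close>, rule le_SucI, rule kV)
    ultimately show "?k \<in> L" unfolding L_def by blast
  qed
  moreover have "(\<Sum>\<kappa>\<in>packed ?A. packed_sign ?A \<kappa>) =
      (\<Sum>\<kappa>\<in>packed ?A - L. packed_sign ?A \<kappa>) + (\<Sum>\<kappa>\<in>L. packed_sign ?A \<kappa>)"
    by (rule sum.subset_diff) (auto simp: L_def intro: finite_packed[OF finA])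
  ultimately show ?case using insert by simp
qed

text \<open>The sum for \<open>E\<close> is that of the deletion plus that of the contraction.
  Deletion creates no loop and supplies the 1; contraction may create one and is then only known to
  be nonnegative, hence the two-part claim.\<close>

lemma sum_packed_colorings:
  assumes "finite V" "E \<subseteq> V \<times> V"
  shows "0 \<le> (\<Sum>\<kappa>\<in>packed_colorings V E. packed_sign V \<kappa>) \<and>
    ((\<forall>v. (v, v) \<notin> E) \<longrightarrow> 1 \<le> (\<Sum>\<kappa>\<in>packed_colorings V E. packed_sign V \<kappa>))"
  using assms
proof (induction "card E" arbitrary: V E rule: less_induct)
  case less
  have finE: "finite E" using less.prems by (meson finite_SigmaI finite_subset)
  show ?case
  proof (cases "\<exists>v. (v, v) \<in> E")
    case True
    then have "packed_colorings V E = {}" by (auto simp: packed_colorings_def)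
    then show ?thesis using True by simp
  next
    case noloop: False
    show ?thesis
    proof (cases "E = {}")
      case True
      then have "packed_colorings V E = packed V" by (auto simp: packed_colorings_def)
      then show ?thesis using sum_packed_sign[OF less.prems(1)] by simp
    next
      case False
      then obtain u v where uv: "(u, v) \<in> E" by auto
      then have uvV: "u \<in> V" "v \<in> V" "u \<noteq> v" using less.prems noloop by auto
      let ?s = "\<lambda>x. if x = v then u else x"
      \<comment> \<open>A single arc is removed. If the opposite arc is present, it turns into a
        loop of \<open>?E2\<close>, whose sum is then 0.\<close>
      let ?E1 = "E - {(u, v)}" and ?W = "V - {v}"
      let ?E2 = "map_prod ?s ?s ` ?E1"
      have card1: "card ?E1 < card E" using finE uv by (rule card_Diff1_less)
      have card2: "card ?E2 < card E"
        using card_image_le[of ?E1 "map_prod ?s ?s"] finE card1 by simp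
      have IH1: "1 \<le> (\<Sum>\<kappa>\<in>packed_colorings V ?E1. packed_sign V \<kappa>)"
        using less.hyps[OF card1, of V] less.prems noloop by auto
      have "?E2 \<subseteq> ?W \<times> ?W" using less.prems uvV by (auto split: if_splits)
      then have IH2: "0 \<le> (\<Sum>\<kappa>\<in>packed_colorings ?W ?E2. packed_sign ?W \<kappa>)"
        using less.hyps[OF card2, of ?W] less.prems by simp
      let ?M = "{\<kappa> \<in> packed_colorings V ?E1. \<kappa> u = \<kappa> v}"
      \<comment> \<open>Colourings that agree at \<open>u\<close> and \<open>v\<close> descend to
        the contraction. A vertex is lost but no colour, as \<open>u\<close> remains; hence the
        minus sign.\<close>
      have "(\<Sum>\<kappa>\<in>?M. - packed_sign V \<kappa>) = (\<Sum>\<kappa>\<in>packed_colorings ?W ?E2. packed_sign ?W \<kappa>)"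
      proof (rule sum.reindex_bij_witness[of _ "\<lambda>\<kappa>. \<kappa>(v := \<kappa> u)" "\<lambda>\<kappa>. restrict \<kappa> ?W"])
        fix \<kappa> assume \<kappa>: "\<kappa> \<in> ?M"
        then have eq: "\<kappa> v = \<kappa> u" by simp
        have img: "restrict \<kappa> ?W ` ?W = \<kappa> ` V"
          using uvV eq by (auto simp: image_iff)
        show "(restrict \<kappa> ?W)(v := restrict \<kappa> ?W u) = \<kappa>"
          using \<kappa> uvV by (auto simp: fun_eq_iff packed_colorings_def packed_def PiE_iff extensional_def)
        have res: "restrict \<kappa> ?W (?s x) = \<kappa> x" if "x \<in> V" for x
          using that uvV eq by simp
        have "\<forall>(x, y)\<in>?E2. restrict \<kappa> ?W x \<noteq> restrict \<kappa> ?W y"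
        proof
          fix e assume "e \<in> ?E2"
          then obtain x y where xy: "(x, y) \<in> ?E1" "e = (?s x, ?s y)" by auto
          then have "x \<in> V" "y \<in> V" using less.prems(2) by auto
          moreover have "\<kappa> x \<noteq> \<kappa> y" using \<kappa> xy(1) unfolding packed_colorings_def by blast
          ultimately show "case e of (x, y) \<Rightarrow> restrict \<kappa> ?W x \<noteq> restrict \<kappa> ?W y"
            unfolding xy(2) prod.case by (simp only: res) simp
        qed
        then show "restrict \<kappa> ?W \<in> packed_colorings ?W ?E2"
          using \<kappa> img unfolding packed_colorings_def packed_def by simp
        show "packed_sign ?W (restrict \<kappa> ?W) = - packed_sign V \<kappa>"
          using card_Suc_Diff1[OF less.prems(1) uvV(2)] unfolding packed_sign_def img
          by (metis add_Suc minus_minus mult_minus1 power_Suc)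
      next
        fix \<kappa> assume \<kappa>: "\<kappa> \<in> packed_colorings ?W ?E2"
        let ?k = "\<kappa>(v := \<kappa> u)"
        show "restrict ?k ?W = \<kappa>"
          using \<kappa> by (auto simp: fun_eq_iff packed_colorings_def packed_def PiE_iff extensional_def)
        have "?k ` V = \<kappa> ` ?W" using uvV by auto
        moreover have "?k \<in> extensional V"
          using \<kappa> uvV by (auto simp: packed_colorings_def packed_def PiE_iff extensional_def)
        ultimately have k_packed: "?k \<in> packed V"
          using \<kappa> unfolding packed_colorings_def packed_def by (simp add: PiE_iff)
        have "?k x \<noteq> ?k y" if "(x, y) \<in> ?E1" for x y
        proof -
          have "(?s x, ?s y) \<in> ?E2" using map_prod_imageI[OF that] .
          moreover have "\<forall>(x, y)\<in>?E2. \<kappa> x \<noteq> \<kappa> y"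
            using \<kappa> unfolding packed_colorings_def mem_Collect_eq by (rule conjunct2)
          ultimately have "\<kappa> (?s x) \<noteq> \<kappa> (?s y)" by (rule bspec[rotated, elim_format]) simp
          then show ?thesis by (auto split: if_splits)
        qed
        then have "\<forall>(x, y)\<in>?E1. ?k x \<noteq> ?k y" by blast
        with k_packed have "?k \<in> packed_colorings V ?E1"
          unfolding packed_colorings_def mem_Collect_eq by (rule conjI)
        then show "?k \<in> ?M" using uvV by simp
      qed
      moreover have union: "packed_colorings V ?E1 = packed_colorings V E \<union> ?M"
        using uv by (auto simp: packed_colorings_def)
      have "(\<Sum>\<kappa>\<in>packed_colorings V ?E1. packed_sign V \<kappa>) =
          (\<Sum>\<kappa>\<in>packed_colorings V E \<union> ?M. packed_sign V \<kappa>)"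
        by (rule arg_cong[OF union])
      moreover have "(\<Sum>\<kappa>\<in>packed_colorings V E \<union> ?M. packed_sign V \<kappa>) =
          (\<Sum>\<kappa>\<in>packed_colorings V E. packed_sign V \<kappa>) + (\<Sum>\<kappa>\<in>?M. packed_sign V \<kappa>)"
        using finite_packed[OF less.prems(1)] uv
        by (intro sum.union_disjoint) (auto simp: packed_colorings_def)
      ultimately have "(\<Sum>\<kappa>\<in>packed_colorings V E. packed_sign V \<kappa>) =
          (\<Sum>\<kappa>\<in>packed_colorings V ?E1. packed_sign V \<kappa>) +
          (\<Sum>\<kappa>\<in>packed_colorings ?W ?E2. packed_sign ?W \<kappa>)"
        unfolding sum_negf by linarith
      then show ?thesis using IH1 IH2 by simp
    qed
  qed
qed

subsection \<open>Coefficients of two-row shapes\<close>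

definition two_colors :: "nat \<Rightarrow> nat \<Rightarrow> nat multiset" where
  "two_colors a b = replicate_mset a 1 + replicate_mset b 2"

text \<open>A missing second row counts as 0. For a given size, a partition with at most two rows is
  determined by this number.\<close>

definition second_row :: "nat list \<Rightarrow> nat" where
  "second_row lam = (if 1 < length lam then lam ! 1 else 0)"

lemma count_two_colors: "count (two_colors a b) x = (if x = 1 then a else if x = 2 then b else 0)"
  by (simp add: two_colors_def)

lemma size_two_colors [simp]: "size (two_colors a b) = a + b"
  by (simp add: two_colors_def)

lemma two_colorsD: "x \<in># two_colors a b \<Longrightarrow> x = 1 \<or> x = 2"
  by (auto simp: two_colors_def split: if_splits)

text \<open>The 1s must fill the first \<open>a\<close> cells of the top row and every other cell
  holds 2, so at most one filling exists. The two bounds say that the second row lies below 1s and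
  that there are enough 2s for it.\<close>

lemma schur_two_rows:
  assumes lam: "lam \<in> partitions" and len: "length lam \<le> 2" and size: "sum_list lam = a + b"
  shows "schur lam (two_colors a b) = (if second_row lam \<le> a \<and> second_row lam \<le> b then 1 else 0)"
proof -
  let ?D = "diagram lam"
  define c where "c = (if lam = [] then 0 else lam ! 0)"
  define d where "d = second_row lam"
  have D: "(i, j) \<in> ?D \<longleftrightarrow> i = 0 \<and> j < c \<or> i = 1 \<and> j < d" for i j
  proof -
    consider "i = 0" | "i = 1" | "2 \<le> i" by linarith
    then show ?thesis using len by cases (auto simp: c_def d_def second_row_def)
  qed
  have D_eq: "?D = {0} \<times> {..<c} \<union> {1} \<times> {..<d}"
    by (auto simp: D simp del: mem_diagram)
  have "card ({0 :: nat} \<times> {..<c} \<union> {1} \<times> {..<d}) = c + d"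
    by (subst card_Un_disjoint) (auto simp: card_cartesian_product)
  then have cd: "c + d = a + b"
    using size card_diagram[of lam] unfolding D_eq by simp
  have dc: "d \<le> c"
    using partitions_antimono[OF lam, of 0 1] by (auto simp: c_def d_def second_row_def)
  define T0 where "T0 = (\<lambda>(i, j)\<in>?D. if i = 0 \<and> j < a then 1 else 2 :: nat)"
  let ?K = "{T \<in> semistandard_tableaux lam. content T ?D = two_colors a b}"
  have uniq: "T = T0 \<and> d \<le> a \<and> d \<le> b" if "T \<in> ?K" for T
  proof -
    have T: "T \<in> semistandard_tableaux lam" and c: "content T ?D = two_colors a b" using that by auto
    have vals: "T x = 1 \<or> T x = 2" if "x \<in> ?D" for x
    proof -
      have "T x \<in># two_colors a b" using that by (simp add: c[symmetric])
      then show ?thesis by (rule two_colorsD)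
    qed
    let ?N = "row_count lam T 1 0"
    have second: "T (1, j) = 2" if "j < d" for j
      using vals[of "(1, j)"] semistandard_row_less[OF lam T, of 1 j] D[of 1 j] that by auto
    have first: "T (0, j) = 1 \<longleftrightarrow> j < ?N" if "j < c" for j
      using row_count_le_iff[OF T, of 0 j 1] D[of 0 j] vals[of "(0, j)"] that by auto
    have Nc: "?N \<le> c" using row_count_mem_diagram[of "?N - 1" lam T 1 0] D[of 0 "?N - 1"] by (cases ?N) auto
    have "{x \<in> ?D. T x = 1} = {0} \<times> {..<?N}"
      using first second Nc by (fastforce simp: D_eq)
    then have N: "?N = a"
      using count_content[of ?D T 1] by (simp add: c count_two_colors card_cartesian_product)
    have "d \<le> ?N"
    proof (rule ccontr)
      assume "\<not> d \<le> ?N"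
      then have "T (0, ?N) < T (1, ?N)" "T (1, ?N) = 2" "?N < c"
        using semistandardD(4)[OF T, of 0 ?N 1] D[of 0 ?N] D[of 1 ?N] second[of ?N] dc by auto
      then show False using first[of ?N] vals[of "(0, ?N)"] D[of 0 ?N] by auto
    qed
    moreover have "T = T0"
    proof (rule extensionalityI[of _ ?D])
      show "T \<in> extensional ?D" by (rule semistandardD(1)[OF T])
      show "T0 \<in> extensional ?D" by (simp add: T0_def)
      fix x assume x: "x \<in> ?D"
      obtain i j where ij: "x = (i, j)" by (cases x)
      then show "T x = T0 x"
        using x D[of i j] first[of j] second[of j] vals[of x] N by (auto simp: T0_def simp del: mem_diagram)
    qed
    ultimately show ?thesis using N Nc cd by simp
  qed
  have T0: "T0 \<in> ?K" if d: "d \<le> a" "d \<le> b"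
  proof -
    have ac: "a \<le> c" using d cd by simp
    have val: "T0 (i, j) = (if i = 0 \<and> j < a then 1 else 2)" if "(i, j) \<in> ?D" for i j
      using that by (simp add: T0_def del: mem_diagram)
    have "T0 \<in> semistandard_tableaux lam"
    proof (rule semistandardI)
      show "T0 \<in> extensional ?D" by (simp add: T0_def)
      show "1 \<le> T0 (i, j)" if "(i, j) \<in> ?D" for i j
        using val[OF that] by simp
      show "T0 (i, j) \<le> T0 (i, j')" if "(i, j) \<in> ?D" "(i, j') \<in> ?D" "j < j'" for i j j'
        using val[OF that(1)] val[OF that(2)] that(3) by auto
      show "T0 (i, j) < T0 (i', j)" if "(i, j) \<in> ?D" "(i', j) \<in> ?D" "i < i'" for i i' j
        using val[OF that(1)] val[OF that(2)] that D[of i j] D[of i' j] d by auto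
    qed
    moreover have "content T0 ?D = two_colors a b"
    proof (rule multiset_eqI)
      fix x
      have "{z \<in> ?D. T0 z = 1} = {0} \<times> {..<a}"
        using ac val D by (fastforce simp del: mem_diagram split: if_splits)
      moreover have "{z \<in> ?D. T0 z = 2} = {0} \<times> {a..<c} \<union> {1} \<times> {..<d}"
        using val D by (fastforce simp del: mem_diagram split: if_splits)
      moreover have "x \<noteq> 1 \<Longrightarrow> x \<noteq> 2 \<Longrightarrow> {z \<in> ?D. T0 z = x} = {}"
        using val by (auto simp del: mem_diagram split: if_splits)
      moreover have "card ({0 :: nat} \<times> {a..<c} \<union> {1} \<times> {..<d}) = b"
        using ac cd by (subst card_Un_disjoint) (auto simp: card_cartesian_product)
      ultimately show "count (content T0 ?D) x = count (two_colors a b) x"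
        unfolding count_content[OF finite_diagram] count_two_colors
        by (cases "x = 1"; cases "x = 2") (simp_all add: card_cartesian_product)
    qed
    ultimately show ?thesis by simp
  qed
  have "?K = (if d \<le> a \<and> d \<le> b then {T0} else {})"
    using uniq T0 by (auto split: if_splits)
  then show ?thesis by (simp add: schur_eq_enumerator enumerator_def d_def)
qed

lemma schur_two_colors:
  assumes lam: "lam \<in> partitions"
  shows "schur lam (two_colors a b) =
    (if length lam \<le> 2 \<and> sum_list lam = a + b \<and> second_row lam \<le> a \<and> second_row lam \<le> b then 1 else 0)"
proof (cases "length lam \<le> 2 \<and> sum_list lam = a + b")
  case True
  then show ?thesis using schur_two_rows[OF lam] by simp
next
  case False
  have "schur lam (two_colors a b) = 0"
  proof (rule ccontr)
    assume "schur lam (two_colors a b) \<noteq> 0"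
    then obtain T where T: "T \<in> semistandard_tableaux lam" "content T (diagram lam) = two_colors a b"
      by (rule schur_nonzeroD)
    have "sum_list lam = a + b"
      using arg_cong[OF T(2), of size] by (simp add: card_diagram)
    then have "(2, 0) \<in> diagram lam" using False partitions_pos[OF lam, of 2] by simp
    then have "2 < T (2, 0)" "T (2, 0) \<in># two_colors a b"
      using semistandard_row_less[OF lam T(1)] by (auto simp: T(2)[symmetric] simp del: mem_diagram)
    then show False using two_colorsD by fastforce
  qed
  then show ?thesis using False by auto
qed

lemma partition_two_rows_iff:
  assumes "lam \<in> partitions" "1 \<le> b" "b \<le> a"
  shows "lam = [a, b] \<longleftrightarrow> length lam \<le> 2 \<and> sum_list lam = a + b \<and> second_row lam = b"
  using assms by (cases lam; cases "tl lam") (auto simp: second_row_def)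

lemma second_row_le:
  assumes "lam \<in> partitions" "length lam \<le> 2"
  shows "2 * second_row lam \<le> sum_list lam"
  using assms by (cases lam; cases "tl lam") (auto simp: second_row_def partitions_def)

lemma two_row_partitions: "1 \<le> b \<Longrightarrow> b \<le> a \<Longrightarrow> [a, b] \<in> partitions"
  by (auto simp: partitions_def)

text \<open>Dual form of the Jacobi--Trudi expansion h_a h_b - h_{a+1} h_{b-1}. On a shape of size a
  + b with at most two rows the difference is [d \<le> b] - [d \<le> b - 1], where d is its second
  row.\<close>

lemma schur_coeff_two_rows:
  assumes F: "F \<in> series.span (schur ` partitions)" and b: "1 \<le> b" "b \<le> a"
  shows "schur_coeff [a, b] F = F (two_colors a b) - F (two_colors (Suc a) (b - 1))"
proof (rule schur_coeff_eqI[OF F two_row_partitions[OF b]])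
  fix mu assume mu: "mu \<in> partitions"
  show "schur mu (two_colors a b) - schur mu (two_colors (Suc a) (b - 1)) = (if mu = [a, b] then 1 else 0)"
    unfolding schur_two_colors[OF mu] partition_two_rows_iff[OF mu b]
    using b second_row_le[OF mu] by auto
qed (simp_all add: scale_series_apply algebra_simps)

subsection \<open>Chromatic symmetric functions\<close>

lemma proper_colorings_subset: "proper_colorings G \<subseteq> pverts G \<rightarrow>\<^sub>E UNIV"
  by (auto simp: proper_colorings_def PiE_iff extensional_def)

lemma chromatic_sym_nonzeroD:
  assumes "chromatic_sym G m \<noteq> 0"
  obtains \<kappa> where "\<kappa> \<in> proper_colorings G" "content \<kappa> (pverts G) = m"
proof -
  have "{\<kappa> \<in> proper_colorings G. content \<kappa> (pverts G) = m} \<noteq> {}"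
  proof
    assume e: "{\<kappa> \<in> proper_colorings G. content \<kappa> (pverts G) = m} = {}"
    show False using assms unfolding chromatic_sym_eq_enumerator enumerator_def e by simp
  qed
  then show ?thesis using that by blast
qed

lemma chromatic_sym_pos:
  assumes "finite (pverts G)" "\<kappa> \<in> proper_colorings G" "content \<kappa> (pverts G) = m"
  shows "0 < chromatic_sym G m"
proof -
  have "finite {\<kappa> \<in> proper_colorings G. content \<kappa> (pverts G) = m}"
    by (rule finite_content_fibre[OF assms(1) proper_colorings_subset])
  then have "0 < card {\<kappa> \<in> proper_colorings G. content \<kappa> (pverts G) = m}"
    using assms by (auto simp: card_gt_0_iff)
  then show ?thesis by (simp add: chromatic_sym_eq_enumerator enumerator_def)
qed

lemma chromatic_sym_nonneg: "0 \<le> chromatic_sym G m"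
  by (simp add: chromatic_sym_eq_enumerator enumerator_def)

lemma chromatic_sym_swap_le:
  assumes G: "pair_fin_digraph G" and a: "1 \<le> a"
  shows "chromatic_sym G m \<le> chromatic_sym G (image_mset (transpose a (Suc a)) m)"
proof -
  interpret pair_fin_digraph G by (rule G)
  note V = pair_finite_verts
  let ?V = "pverts G"
  let ?K = "\<lambda>m. {\<kappa> \<in> proper_colorings G. content \<kappa> ?V = m}"
  let ?f = "\<lambda>\<kappa>. \<lambda>x\<in>?V. transpose a (Suc a) (\<kappa> x)"
  have "card (?K m) \<le> card (?K (image_mset (transpose a (Suc a)) m))"
  proof (rule card_inj_on_le)
    show "inj_on ?f (?K m)"
    proof (rule inj_on_inverseI)
      show "?f (?f \<kappa>) = \<kappa>" if "\<kappa> \<in> ?K m" for \<kappa>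
        using that by (auto simp: fun_eq_iff proper_colorings_def PiE_iff extensional_def)
    qed
    show "?f ` ?K m \<subseteq> ?K (image_mset (transpose a (Suc a)) m)"
    proof clarify
      fix \<kappa> assume \<kappa>: "\<kappa> \<in> proper_colorings G"
      have pos: "1 \<le> transpose a (Suc a) x" if "1 \<le> x" for x
        using that a by (auto simp: transpose_def)
      have "content (?f \<kappa>) ?V = image_mset (transpose a (Suc a)) (content \<kappa> ?V)"
        using V unfolding content_def by (auto simp: multiset.map_comp intro!: image_mset_cong)
      moreover have "?f \<kappa> \<in> proper_colorings G"
        unfolding proper_colorings_def
      proof (intro CollectI conjI ballI)
        show "?f \<kappa> \<in> ?V \<rightarrow>\<^sub>E {1..}"
          using \<kappa> pos by (simp add: proper_colorings_def PiE_iff)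
        fix e assume e: "e \<in> parcs G"
        then have "\<kappa> (fst e) \<noteq> \<kappa> (snd e)" using \<kappa> by (auto simp: proper_colorings_def)
        then have "?f \<kappa> (fst e) \<noteq> ?f \<kappa> (snd e)"
          using arc_fst_in_verts[OF e] arc_snd_in_verts[OF e] by simp (metis transpose_involutory)
        then show "case e of (u, v) \<Rightarrow> ?f \<kappa> u \<noteq> ?f \<kappa> v" by (simp add: case_prod_unfold)
      qed
      ultimately show "?f \<kappa> \<in> proper_colorings G \<and>
          content (?f \<kappa>) ?V = image_mset (transpose a (Suc a)) (content \<kappa> ?V)" by simp
    qed
    show "finite (?K (image_mset (transpose a (Suc a)) m))"
      by (rule finite_content_fibre[OF V proper_colorings_subset])
  qed
  then show ?thesis by (simp add: chromatic_sym_eq_enumerator enumerator_def)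
qed

lemma chromatic_sym_symmetric:
  assumes G: "pair_fin_digraph G"
  shows "chromatic_sym G \<in> symmetric_series (card (pverts G))"
  unfolding symmetric_series_def
proof (intro CollectI conjI allI impI)
  fix m assume "chromatic_sym G m \<noteq> 0"
  then obtain \<kappa> where \<kappa>: "\<kappa> \<in> proper_colorings G" "content \<kappa> (pverts G) = m"
    by (rule chromatic_sym_nonzeroD)
  interpret pair_fin_digraph G by (rule G)
  have "0 \<notin> \<kappa> ` pverts G" using \<kappa>(1) by (force simp: proper_colorings_def PiE_iff)
  then show "0 \<notin># m" by (simp add: \<kappa>(2)[symmetric] pair_finite_verts)
  show "size m = card (pverts G)" by (simp add: \<kappa>(2)[symmetric])
next
  fix m and a :: nat assume "a \<ge> 1"
  moreover have "image_mset (transpose a (Suc a)) (image_mset (transpose a (Suc a)) m) = m"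
    by (simp add: multiset.map_comp)
  ultimately show "chromatic_sym G (image_mset (transpose a (Suc a)) m) = chromatic_sym G m"
    using chromatic_sym_swap_le[OF G] by (metis order_antisym)
qed

lemma chromatic_sym_span:
  "pair_fin_digraph G \<Longrightarrow> chromatic_sym G \<in> series.span (schur ` partitions)"
  by (rule symmetric_series_span[OF chromatic_sym_symmetric])

lemma pair_graph_fin: "pair_graph G \<Longrightarrow> pair_fin_digraph G"
proof -
  assume "pair_graph G"
  then interpret pair_graph G .
  show ?thesis ..
qed

text \<open>The column functional turns the coefficient into the signed sum over gap-free proper
  colourings. Positivity makes the ratio in \<open>X_s\<close> positive, so multiplying by it cannot
  change a sign.\<close>

lemma schur_coeff_column_pos:
  assumes "pair_graph G"
  shows "0 < schur_coeff (replicate (card (pverts G)) 1) (chromatic_sym G)"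
proof -
  interpret pair_graph G by (rule assms)
  let ?V = "pverts G"
  have "replicate (card ?V) 1 \<in> partitions"
    by (auto simp: partitions_def sorted_wrt_iff_nth_less)
  then have "schur_coeff (replicate (card ?V) 1) (chromatic_sym G) =
      alternating_coeff (card ?V) (chromatic_sym G)"
    by (intro schur_coeff_eqI chromatic_sym_span pair_fin_digraph alternating_coeff_add
        alternating_coeff_scale alternating_coeff_schur)
  also have "\<dots> = (\<Sum>\<kappa>\<in>proper_colorings G \<inter> packed ?V. packed_sign ?V \<kappa>)"
    unfolding chromatic_sym_eq_enumerator
    by (rule alternating_coeff_enumerator[OF pair_finite_verts proper_colorings_subset])
  also have "proper_colorings G \<inter> packed ?V = packed_colorings ?V (parcs G)"
  proof -
    have "\<kappa> \<in> ?V \<rightarrow>\<^sub>E {1..}" if \<kappa>: "\<kappa> \<in> packed ?V" for \<kappa>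
    proof -
      obtain l where "\<kappa> ` ?V = {1..l}" using \<kappa> unfolding packed_def by blast
      then have "\<kappa> x \<in> {1..l}" if "x \<in> ?V" for x using that by blast
      then show ?thesis using \<kappa> by (simp add: packed_def PiE_iff)
    qed
    then show ?thesis unfolding proper_colorings_def packed_colorings_def by blast
  qed
  also have "(\<Sum>\<kappa>\<in>packed_colorings ?V (parcs G). packed_sign ?V \<kappa>) \<ge> 1"
    using sum_packed_colorings[OF pair_finite_verts, of "parcs G"] arc_fst_in_verts arc_snd_in_verts no_loops'
    by fastforce
  finally show ?thesis by simp
qed

subsection \<open>Stars\<close>

text \<open>Vertex set and centre are left free because the class of the star contains its copies on
  any \<open>n\<close> natural numbers.\<close>

definition star_at :: "nat pair_pre_digraph \<Rightarrow> nat \<Rightarrow> bool" where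
  "star_at G c \<longleftrightarrow> c \<in> pverts G \<and> parcs G = {c} \<times> (pverts G - {c}) \<union> (pverts G - {c}) \<times> {c}"

lemma star_at_proper_iff:
  assumes "star_at G c"
  shows "\<kappa> \<in> proper_colorings G \<longleftrightarrow>
    \<kappa> \<in> pverts G \<rightarrow>\<^sub>E {1..} \<and> (\<forall>x\<in>pverts G - {c}. \<kappa> x \<noteq> \<kappa> c)"
  using assms by (fastforce simp: star_at_def proper_colorings_def)

text \<open>Colourings are pulled back along a bijection that matches the centres. The inequality
  suffices because the two stars can change places.\<close>

lemma chromatic_sym_star_le:
  assumes G: "star_at G c" "finite (pverts G)" and H: "star_at H d" "finite (pverts H)"
    and card: "card (pverts G) = card (pverts H)"
  shows "chromatic_sym G m \<le> chromatic_sym H m"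
proof -
  let ?V = "pverts G" and ?W = "pverts H"
  have c: "c \<in> ?V" and d: "d \<in> ?W" using G H by (auto simp: star_at_def)
  have "card (?W - {d}) = card (?V - {c})" using card c d by simp
  then obtain g where g: "bij_betw g (?W - {d}) (?V - {c})"
    using finite_same_card_bij G(2) H(2) by (metis finite_Diff)
  define f where "f = g(d := c)"
  have f: "bij_betw f ?W ?V"
  proof -
    have "bij_betw f (?W - {d}) (?V - {c})"
      using g by (rule iffD1[OF bij_betw_cong, rotated]) (simp add: f_def)
    moreover have "bij_betw f {d} {c}" by (simp add: f_def bij_betw_def)
    ultimately have "bij_betw f ((?W - {d}) \<union> {d}) ((?V - {c}) \<union> {c})"
      by (rule bij_betw_combine) auto
    then show ?thesis using c d by (simp add: insert_absorb)
  qed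
  have fd: "f d = c" by (simp add: f_def)
  have fV: "f x \<in> ?V" if "x \<in> ?W" for x using f that by (auto simp: bij_betw_def)
  have fc: "f x \<noteq> c" if "x \<in> ?W - {d}" for x
    using f fd d that unfolding bij_betw_def inj_on_def by blast
  let ?h = "\<lambda>\<kappa>. \<lambda>x\<in>?W. \<kappa> (f x)"
  let ?K = "\<lambda>G. {\<kappa> \<in> proper_colorings G. content \<kappa> (pverts G) = m}"
  have "card (?K G) \<le> card (?K H)"
  proof (rule card_inj_on_le)
    show "inj_on ?h (?K G)"
    proof (rule inj_onI)
      fix \<kappa> \<kappa>' assume *: "\<kappa> \<in> ?K G" "\<kappa>' \<in> ?K G" "?h \<kappa> = ?h \<kappa>'"
      show "\<kappa> = \<kappa>'"
      proof (rule extensionalityI[of _ ?V])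
        show "\<kappa> \<in> extensional ?V" "\<kappa>' \<in> extensional ?V"
          using * by (auto simp: proper_colorings_def PiE_iff)
        fix y assume "y \<in> ?V"
        then obtain x where "x \<in> ?W" "y = f x" using f by (auto simp: bij_betw_def)
        then show "\<kappa> y = \<kappa>' y" using fun_cong[OF *(3), of x] by simp
      qed
    qed
    show "?h ` ?K G \<subseteq> ?K H"
    proof clarify
      fix \<kappa> assume \<kappa>: "\<kappa> \<in> proper_colorings G" and m: "m = content \<kappa> ?V"
      have "mset_set ?V = image_mset f (mset_set ?W)"
        using f by (metis bij_betw_def image_mset_mset_set)
      then have "content (?h \<kappa>) ?W = content \<kappa> ?V"
        using H(2) by (auto simp: content_def multiset.map_comp intro!: image_mset_cong)
      moreover have "?h \<kappa> \<in> proper_colorings H"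
        using \<kappa> fV fc fd d unfolding star_at_proper_iff[OF G(1)] star_at_proper_iff[OF H(1)]
        by (auto simp: PiE_iff)
      ultimately show "?h \<kappa> \<in> proper_colorings H \<and> content (?h \<kappa>) ?W = content \<kappa> ?V" by simp
    qed
    show "finite (?K H)"
      by (rule finite_content_fibre[OF H(2) proper_colorings_subset])
  qed
  then show ?thesis by (simp add: chromatic_sym_eq_enumerator enumerator_def)
qed

lemma chromatic_sym_star_eq:
  assumes "star_at G c" "finite (pverts G)" "star_at H d" "finite (pverts H)"
    and "card (pverts G) = card (pverts H)"
  shows "chromatic_sym G = chromatic_sym H"
  using assms by (intro ext antisym chromatic_sym_star_le) auto

lemma star_at_star_graph: "1 \<le> n \<Longrightarrow> star_at (star_graph n) n"
  by (auto simp: star_at_def star_graph_def)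

lemma star_graph_connected:
  assumes "2 \<le> n"
  shows "star_graph n \<in> connected_graphs n"
proof -
  let ?S = "star_graph n"
  have "pair_graph ?S"
  proof
    show "symmetric (with_proj ?S)"
      by (auto simp: symmetric_def star_graph_def sym_def)
  qed (use assms in \<open>auto simp: star_graph_def\<close>)
  moreover have "Digraph_Component.connected (with_proj ?S)"
    unfolding connected_conv
  proof (intro conjI ballI)
    let ?R = "rtrancl_on (pverts ?S) ((parcs ?S)\<^sup>s)"
    have n: "(n, n) \<in> ?R" using assms by (intro rtrancl_on_refl) (simp add: star_graph_def)
    have to: "(u, n) \<in> ?R" if "u \<in> pverts ?S" for u
    proof (cases "u = n")
      case False
      then have "(u, n) \<in> (parcs ?S)\<^sup>s" using that by (auto simp: star_graph_def symcl_def)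
      then show ?thesis using n that by (rule converse_rtrancl_on_into_rtrancl_on)
    qed (use n in simp)
    have out: "(n, v) \<in> ?R" if "v \<in> pverts ?S" for v
    proof (cases "v = n")
      case False
      then have "(n, v) \<in> (parcs ?S)\<^sup>s" using that by (auto simp: star_graph_def symcl_def)
      then show ?thesis by (rule rtrancl_on_into_rtrancl_on[OF n _ that])
    qed (use n in simp)
    show "verts (with_proj ?S) \<noteq> {}" using assms by (auto simp: star_graph_def)
    fix u v assume "u \<in> verts (with_proj ?S)" "v \<in> verts (with_proj ?S)"
    then show "(u, v) \<in> rtrancl_on (verts (with_proj ?S)) ((arcs_ends (with_proj ?S))\<^sup>s)"
      using rtrancl_on_trans[OF to out] by simp
  qed
  ultimately show ?thesis by (simp add: connected_graphs_def) (simp add: star_graph_def)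
qed

section \<open>Recognising stars by two-colour contents\<close>

lemma connected_arc_exists:
  assumes "G \<in> connected_graphs n" "u \<in> pverts G" "v \<in> pverts G" "u \<noteq> v"
  obtains w where "(u, w) \<in> parcs G"
proof -
  interpret pair_graph G using assms(1) by (simp add: connected_graphs_def)
  have "(u, v) \<in> rtrancl_on (pverts G) ((parcs G)\<^sup>s)"
    using assms unfolding connected_graphs_def connected_conv by auto
  then obtain w where "(u, w) \<in> (parcs G)\<^sup>s"
    using assms(4) by (cases rule: converse_rtrancl_on_cases) auto
  then have "(u, w) \<in> parcs G \<or> (w, u) \<in> parcs G" by (auto simp: symcl_def)
  then show ?thesis using that pair_sym_arcs by (auto simp: symmetric_def sym_def)
qed

text \<open>Some arc exists, and a single colour would make its ends equal. This removes the
  subtracted term in the coefficient of the shape (n-1,1).\<close>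

lemma chromatic_sym_monochrome:
  assumes G: "G \<in> connected_graphs n" and n: "2 \<le> n"
  shows "chromatic_sym G (two_colors n 0) = 0"
proof (rule ccontr)
  assume "chromatic_sym G (two_colors n 0) \<noteq> 0"
  then obtain \<kappa> where \<kappa>: "\<kappa> \<in> proper_colorings G" "content \<kappa> (pverts G) = two_colors n 0"
    by (rule chromatic_sym_nonzeroD)
  interpret pair_graph G using G by (simp add: connected_graphs_def)
  have one: "\<kappa> x = 1" if "x \<in> pverts G" for x
  proof -
    have "\<kappa> x \<in># two_colors n 0" using that pair_finite_verts by (simp add: \<kappa>(2)[symmetric])
    then show ?thesis by (simp add: two_colors_def split: if_splits)
  qed
  have "1 < card (pverts G)" using G n by (simp add: connected_graphs_def)
  then obtain u v where "u \<in> pverts G" "v \<in> pverts G" "u \<noteq> v"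
    by (metis One_nat_def card_le_Suc0_iff_eq not_less pair_finite_verts)
  then obtain w where w: "(u, w) \<in> parcs G" using connected_arc_exists[OF G] by blast
  then have "\<kappa> u \<noteq> \<kappa> w" using \<kappa>(1) by (auto simp: proper_colorings_def)
  then show False using one in_arcsD1[OF w] in_arcsD2[OF w] by simp
qed

text \<open>The one vertex of colour 2 is the centre: all others share colour 1, so every arc meets
  it, and connectedness gives each of them an arc.\<close>

lemma star_at_if_coeff_nonzero:
  assumes G: "G \<in> connected_graphs n" and n: "2 \<le> n"
    and nz: "chromatic_sym G (two_colors (n - 1) 1) \<noteq> 0"
  obtains c where "star_at G c"
proof -
  obtain \<kappa> where \<kappa>: "\<kappa> \<in> proper_colorings G" "content \<kappa> (pverts G) = two_colors (n - 1) 1"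
    using nz by (rule chromatic_sym_nonzeroD)
  interpret pair_graph G using G by (simp add: connected_graphs_def)
  have vals: "\<kappa> x = 1 \<or> \<kappa> x = 2" if "x \<in> pverts G" for x
  proof -
    have "\<kappa> x \<in># two_colors (n - 1) 1"
      unfolding \<kappa>(2)[symmetric] set_mset_content[OF pair_finite_verts] using that by (rule imageI)
    then show ?thesis by (rule two_colorsD)
  qed
  have "card {x \<in> pverts G. \<kappa> x = 2} = 1"
    using count_content[OF pair_finite_verts, of \<kappa> 2] by (simp add: \<kappa>(2) count_two_colors)
  then obtain c where c: "{x \<in> pverts G. \<kappa> x = 2} = {c}" by (rule card_1_singletonE)
  have cV: "c \<in> pverts G" "\<kappa> c = 2" using c by auto
  have other: "\<kappa> x = 1" if "x \<in> pverts G" "x \<noteq> c" for x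
    using vals[OF that(1)] c that by auto
  have sym: "(y, x) \<in> parcs G" if "(x, y) \<in> parcs G" for x y
    using that pair_sym_arcs by (auto simp: symmetric_def sym_def)
  have proper: "\<kappa> x \<noteq> \<kappa> y" if "(x, y) \<in> parcs G" for x y
    using that \<kappa>(1) by (auto simp: proper_colorings_def)
  have incident: "x = c \<and> y \<noteq> c \<or> y = c \<and> x \<noteq> c" if "(x, y) \<in> parcs G" for x y
    using proper[OF that] other[of x] other[of y] in_arcsD1[OF that] in_arcsD2[OF that] by metis
  have leaf: "(x, c) \<in> parcs G" if x: "x \<in> pverts G" "x \<noteq> c" for x
  proof -
    obtain w where "(x, w) \<in> parcs G" using connected_arc_exists[OF G x(1) cV(1) x(2)] by blast
    then show ?thesis using incident[of x w] x(2) by blast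
  qed
  have "parcs G = {c} \<times> (pverts G - {c}) \<union> (pverts G - {c}) \<times> {c}"
  proof (intro equalityI subrelI)
    fix x y assume xy: "(x, y) \<in> parcs G"
    then show "(x, y) \<in> {c} \<times> (pverts G - {c}) \<union> (pverts G - {c}) \<times> {c}"
      using incident[OF xy] in_arcsD1[OF xy] in_arcsD2[OF xy] by blast
  next
    fix x y assume "(x, y) \<in> {c} \<times> (pverts G - {c}) \<union> (pverts G - {c}) \<times> {c}"
    then show "(x, y) \<in> parcs G" using leaf sym by blast
  qed
  then show ?thesis using that cV by (auto simp: star_at_def)
qed

lemma star_graph_coeff_pos:
  assumes "2 \<le> n"
  shows "0 < chromatic_sym (star_graph n) (two_colors (n - 1) 1)"
proof (rule chromatic_sym_pos)
  let ?\<kappa> = "\<lambda>x\<in>{1..n}. if x = n then 2 else 1 :: nat"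
  have V: "pverts (star_graph n) = {1..n}" by (simp add: star_graph_def)
  show "finite (pverts (star_graph n))" by (simp add: V)
  show "?\<kappa> \<in> proper_colorings (star_graph n)"
    using assms by (subst star_at_proper_iff[OF star_at_star_graph]) (auto simp: V)
  show "content ?\<kappa> (pverts (star_graph n)) = two_colors (n - 1) 1"
  proof (rule multiset_eqI)
    fix x
    have "{i \<in> {1..n}. ?\<kappa> i = x} = (if x = 1 then {1..n - 1} else if x = 2 then {n} else {})"
      using assms by auto
    then show "count (content ?\<kappa> (pverts (star_graph n))) x = count (two_colors (n - 1) 1) x"
      unfolding V by (simp add: count_content count_two_colors)
  qed
qed

lemma star_graph_coeff_0:
  assumes "4 \<le> n"
  shows "chromatic_sym (star_graph n) (two_colors (n - 2) 2) = 0"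
proof (rule ccontr)
  let ?V = "pverts (star_graph n)"
  assume "chromatic_sym (star_graph n) (two_colors (n - 2) 2) \<noteq> 0"
  then obtain \<kappa> where \<kappa>: "\<kappa> \<in> proper_colorings (star_graph n)" "content \<kappa> ?V = two_colors (n - 2) 2"
    by (rule chromatic_sym_nonzeroD)
  have fin: "finite ?V" and nV: "n \<in> ?V" using assms by (auto simp: star_graph_def)
  have "{x \<in> ?V. \<kappa> x = \<kappa> n} = {n}"
    using \<kappa>(1) nV assms by (subst (asm) star_at_proper_iff[OF star_at_star_graph]) auto
  then have "count (two_colors (n - 2) 2) (\<kappa> n) = 1"
    using count_content[OF fin, of \<kappa> "\<kappa> n"] \<kappa>(2) by simp
  \<comment> \<open>The multiplicities present are \<open>n - 2\<close> and 2, and neither is 1 when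
    \<open>n\<close> is at least 4.\<close>
  then show False using assms by (simp add: count_two_colors split: if_splits)
qed

section \<open>Incomparability with the star\<close>

lemma schur_coeff_X_s:
  assumes "pair_fin_digraph G" "pair_fin_digraph H"
  shows "schur_coeff lam (X_s G H) = schur_coeff lam (chromatic_sym G) -
    schur_coeff (replicate (card (pverts G)) 1) (chromatic_sym G) /
    schur_coeff (replicate (card (pverts H)) 1) (chromatic_sym H) * schur_coeff lam (chromatic_sym H)"
  unfolding X_s_def
  using chromatic_sym_span[OF assms(1)] chromatic_sym_span[OF assms(2)] independent_schur
  unfolding schur_coeff_def
  by (subst series.representation_diff) (auto intro: series.span_scale simp: series.representation_scale)

lemma star_incomparable:
  assumes n: "4 \<le> n" and G: "G \<in> connected_graphs n" and H: "H \<in> connected_graphs n"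
    and GS: "chromatic_sym G = chromatic_sym (star_graph n)"
    and HS: "chromatic_sym H \<noteq> chromatic_sym (star_graph n)"
  shows "\<not> schur_positive (X_s G H)" "\<not> schur_positive (X_s H G)"
proof -
  let ?S = "chromatic_sym (star_graph n)"
  have pair: "pair_graph G" "pair_graph H" and card: "card (pverts G) = n" "card (pverts H) = n"
    using G H by (auto simp: connected_graphs_def)
  have fin: "pair_fin_digraph G" "pair_fin_digraph H"
    using pair by (auto intro: pair_graph_fin)
  have H0: "chromatic_sym H (two_colors (n - 1) 1) = 0"
  proof (rule ccontr)
    assume "chromatic_sym H (two_colors (n - 1) 1) \<noteq> 0"
    then obtain c where "star_at H c"
      using star_at_if_coeff_nonzero[OF H] n by auto
    then have "chromatic_sym H = ?S"
      using chromatic_sym_star_eq[OF _ _ star_at_star_graph, of H c n] n card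
        pair_fin_digraph.pair_finite_verts[OF fin(2)]
      by (simp add: star_graph_def)
    then show False using HS by simp
  qed
  have hook: "schur_coeff [n - 1, 1] (chromatic_sym F) = chromatic_sym F (two_colors (n - 1) 1)"
    if "F \<in> connected_graphs n" "pair_fin_digraph F" for F
    using schur_coeff_two_rows[OF chromatic_sym_span[OF that(2)], of 1 "n - 1"]
      chromatic_sym_monochrome[OF that(1)] n by simp
  have two: "schur_coeff [n - 2, 2] (chromatic_sym F) =
      chromatic_sym F (two_colors (n - 2) 2) - chromatic_sym F (two_colors (n - 1) 1)"
    if "pair_fin_digraph F" for F :: "nat pair_pre_digraph"
  proof -
    have "Suc (n - 2) = n - 1" using n by simp
    then show ?thesis
      using schur_coeff_two_rows[OF chromatic_sym_span[OF that], of 2 "n - 2"] n by simp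
  qed
  have posG: "0 < schur_coeff (replicate n 1) (chromatic_sym G)"
    and posH: "0 < schur_coeff (replicate n 1) (chromatic_sym H)"
    using schur_coeff_column_pos[OF pair(1)] schur_coeff_column_pos[OF pair(2)] card by auto
  have pos: "0 < ?S (two_colors (n - 1) 1)" using star_graph_coeff_pos n by simp
  \<comment> \<open>The star contributes 0 minus a positive number, and the subtracted multiple of
    the coefficient of \<open>H\<close> is nonnegative.\<close>
  have "schur_coeff [n - 2, 2] (X_s G H) =
      - ?S (two_colors (n - 1) 1) -
      schur_coeff (replicate n 1) (chromatic_sym G) / schur_coeff (replicate n 1) (chromatic_sym H) *
      chromatic_sym H (two_colors (n - 2) 2)"
    unfolding schur_coeff_X_s[OF fin(1,2)] card two[OF fin(1)] two[OF fin(2)]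
    unfolding H0 GS star_graph_coeff_0[OF n] by simp
  moreover have "0 \<le> schur_coeff (replicate n 1) (chromatic_sym G) /
      schur_coeff (replicate n 1) (chromatic_sym H) * chromatic_sym H (two_colors (n - 2) 2)"
    using posG posH by (intro mult_nonneg_nonneg divide_nonneg_nonneg chromatic_sym_nonneg) auto
  ultimately have "schur_coeff [n - 2, 2] (X_s G H) < 0" using pos by linarith
  moreover have "[n - 2, 2] \<in> partitions" using n by (intro two_row_partitions) auto
  ultimately show "\<not> schur_positive (X_s G H)" unfolding schur_positive_def by (meson not_le)
  have "schur_coeff [n - 1, 1] (X_s H G) =
      - (schur_coeff (replicate n 1) (chromatic_sym H) / schur_coeff (replicate n 1) (chromatic_sym G) *
      ?S (two_colors (n - 1) 1))"
    unfolding schur_coeff_X_s[OF fin(2,1)] card hook[OF G fin(1)] hook[OF H fin(2)]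
    unfolding H0 GS by simp
  moreover have "0 < schur_coeff (replicate n 1) (chromatic_sym H) /
      schur_coeff (replicate n 1) (chromatic_sym G) * ?S (two_colors (n - 1) 1)"
    using posG posH pos by (intro mult_pos_pos divide_pos_pos)
  ultimately have "schur_coeff [n - 1, 1] (X_s H G) < 0" by linarith
  moreover have "[n - 1, 1] \<in> partitions" using n by (intro two_row_partitions) auto
  ultimately show "\<not> schur_positive (X_s H G)" unfolding schur_positive_def by (meson not_le)
qed

theorem proposition4p12:
  fixes n :: nat
  assumes "n \<ge> 4"
  shows "independent_element (chromatic_poset n) (chromatic_equiv n `` {star_graph n})"
proof -
  let ?S = "star_graph n"
  have S: "?S \<in> connected_graphs n" using assms by (intro star_graph_connected) simp
  have carrier: "carrier (chromatic_poset n) = connected_graphs n // chromatic_equiv n"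
    by (simp add: chromatic_poset_def)
  \<comment> \<open>The order relates classes through some pair of representatives, so every pair
    has to be refuted.\<close>
  have incomparable: "\<not> schur_positive (X_s G H) \<and> \<not> schur_positive (X_s H G)"
    if B: "B \<in> connected_graphs n // chromatic_equiv n" "B \<noteq> chromatic_equiv n `` {?S}"
      and GH: "G \<in> chromatic_equiv n `` {?S}" "H \<in> B" for B G H
  proof -
    have G: "G \<in> connected_graphs n" "chromatic_sym G = chromatic_sym ?S"
      using GH(1) by (auto simp: chromatic_equiv_def)
    obtain F where F: "F \<in> connected_graphs n" "B = chromatic_equiv n `` {F}"
      using B(1) by (rule quotientE)
    have H: "H \<in> connected_graphs n" "chromatic_sym H = chromatic_sym F"
      using GH(2) F(2) by (auto simp: chromatic_equiv_def)
    have "chromatic_sym F \<noteq> chromatic_sym ?S"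
    proof
      assume "chromatic_sym F = chromatic_sym ?S"
      then have "B = chromatic_equiv n `` {?S}"
        using F S by (auto simp: chromatic_equiv_def)
      then show False using B(2) by simp
    qed
    then show ?thesis using star_incomparable[OF assms G(1) H(1) G(2)] H(2) by simp
  qed
  have "chromatic_equiv n `` {?S} \<in> connected_graphs n // chromatic_equiv n"
    using S by (rule quotientI)
  then show ?thesis
    unfolding independent_element_def carrier
    using incomparable by (auto simp: chromatic_poset_def)
qed

end
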